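(* For any $\beta\ge 1$, given a metric ATSP instance $G$ on $n$ vertices together with a minimum spanning arborescence $A$ of $G$, a tour of cost at most $(2+\beta)\,c^*(G)$ can be computed in time $\mathcal{O}(2^{k_\beta}k_\beta^2+n^2)$, where $k_\beta$ is the number of $\beta$-one-way edges in $A$.
   Context: Metric ATSP: given a simple complete directed graph $G=(V,E,c)$ with non-negative edge costs satisfying $c(u,v)+c(v,w)\ge c(u,w)$ for all $u,v,w\in V$, find a minimum-cost tour (directed cycle visiting each vertex exactly once); $c^*(G)$ is the optimal cost. A spanning arborescence is a spanning directed tree with a root from which all vertices are reachable; a minimum spanning arborescence has minimum total cost. An edge $(u,v)$ is a one-way edge if $c(u,v)<c(v,u)$. For $\beta\ge1$, an edge $(u,v)$ is $\beta$-symmetric if $\frac1\beta\le\frac{c(u,v)}{c(v,u)}\le\beta$ and $\beta$-asymmetric otherwise; a $\beta$-one-way edge is a one-way edge that is $\beta$-asymmetric. *)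

theory Defs
  imports "Graph_Theory.Graph_Theory"
begin

section \<open>Metric ATSP\<close>

text \<open>
  Costs are only meaningful on arcs and the complete digraph has no loops, so the triangle
  inequality is imposed for pairwise distinct vertices.  With loops costing \<open>0\<close> the remaining
  triples would follow from non-negativity.\<close>

definition metric_atsp :: "'a pair_pre_digraph \<Rightarrow> ('a \<times> 'a) weight_fun \<Rightarrow> bool" where
  "metric_atsp G c \<longleftrightarrow>
     complete_digraph (card (pverts G)) (with_proj G) \<and>
     (\<forall>e \<in> parcs G. 0 \<le> c e) \<and>
     (\<forall>u \<in> pverts G. \<forall>v \<in> pverts G. \<forall>w \<in> pverts G.
        u \<noteq> v \<longrightarrow> v \<noteq> w \<longrightarrow> u \<noteq> w \<longrightarrow> c (u, w) \<le> c (u, v) + c (v, w))"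

text \<open>Tours are lists of arcs; a \<^const>\<open>pre_digraph.cycle\<close> repeats no vertex.\<close>

definition tour :: "'a pair_pre_digraph \<Rightarrow> ('a \<times> 'a) awalk \<Rightarrow> bool" where
  "tour G p \<longleftrightarrow> pre_digraph.cycle (with_proj G) p \<and> fst ` set p = pverts G"

definition tour_cost :: "('a \<times> 'a) weight_fun \<Rightarrow> ('a \<times> 'a) awalk \<Rightarrow> real" where
  "tour_cost c p = sum_list (map c p)"

definition opt_cost :: "'a pair_pre_digraph \<Rightarrow> ('a \<times> 'a) weight_fun \<Rightarrow> real" where
  "opt_cost G c = Min (tour_cost c ` {p. tour G p})"

section \<open>Arborescences\<close>

text \<open>
  A directed tree is a digraph whose underlying undirected graph is a tree.  The library constant
  \<^const>\<open>tree\<close> only excludes directed cycles (a transitively oriented triangle satisfies it), so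
  it cannot be used here.  The undirected cycles of a digraph are the pairs of antiparallel arcs and
  the cycles with at least three arcs of its symmetric closure.
\<close>

definition directed_tree :: "'a pair_pre_digraph \<Rightarrow> bool" where
  "directed_tree T \<longleftrightarrow>
     connected (with_proj T) \<and>
     (\<forall>u v. (u, v) \<in> parcs T \<longrightarrow> (v, u) \<notin> parcs T) \<and>
     \<not> (\<exists>p. pre_digraph.cycle (with_proj (mk_symmetric (with_proj T))) p \<and> 3 \<le> length p)"

definition spanning_arborescence :: "'a pair_pre_digraph \<Rightarrow> 'a pair_pre_digraph \<Rightarrow> bool" where
  "spanning_arborescence G A \<longleftrightarrow>
     spanning (with_proj A) (with_proj G) \<and> directed_tree A \<and>
     (\<exists>r \<in> pverts A. \<forall>v \<in> pverts A. r \<rightarrow>\<^sup>*\<^bsub>with_proj A\<^esub> v)"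

definition min_spanning_arborescence ::
    "'a pair_pre_digraph \<Rightarrow> ('a \<times> 'a) weight_fun \<Rightarrow> 'a pair_pre_digraph \<Rightarrow> bool" where
  "min_spanning_arborescence G c A \<longleftrightarrow>
     spanning_arborescence G A \<and>
     (\<forall>B. spanning_arborescence G B \<longrightarrow> sum c (parcs A) \<le> sum c (parcs B))"

section \<open>Asymmetric arcs\<close>

definition one_way :: "('a \<times> 'a) weight_fun \<Rightarrow> 'a \<times> 'a \<Rightarrow> bool" where
  "one_way c e \<longleftrightarrow> c e < c (prod.swap e)"

text \<open>
  If exactly one of the two costs is zero, the ratio is \<open>0\<close> or \<open>\<infinity>\<close> and the arc is asymmetric;
  Isabelle's \<open>x / 0 = 0\<close> gives the same verdict.  If both are zero the arc counts as asymmetric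
  here, but it is not one-way, so \<open>beta_one_way\<close> does not depend on that choice.
\<close>

definition beta_symmetric :: "real \<Rightarrow> ('a \<times> 'a) weight_fun \<Rightarrow> 'a \<times> 'a \<Rightarrow> bool" where
  "beta_symmetric \<beta> c e \<longleftrightarrow> 1 / \<beta> \<le> c e / c (prod.swap e) \<and> c e / c (prod.swap e) \<le> \<beta>"

definition beta_one_way :: "real \<Rightarrow> ('a \<times> 'a) weight_fun \<Rightarrow> 'a \<times> 'a \<Rightarrow> bool" where
  "beta_one_way \<beta> c e \<longleftrightarrow> one_way c e \<and> \<not> beta_symmetric \<beta> c e"

section \<open>Machine model\<close>

text \<open>
  Running times are measured on a real RAM, presented as a small structured language.
  The machine has natural-number memory (for indices and control) and real memory (for costs), both
  divided into named arrays; a program mentions only finitely many names, and a scalar variable is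
  cell \<open>0\<close> of an array.  Every memory access, every arithmetic operation, every comparison and
  every control step takes one unit of time.  On natural numbers there are only addition and
  truncated subtraction, as in the unit-cost RAM of Cook and Reckhow; there is no way to convert a
  real into a natural number, and the only constants are natural numbers.
\<close>

type_synonym name = string

datatype nexp =
    NConst nat
  | NCell name nexp
  | NPlus nexp nexp
  | NMinus nexp nexp

datatype rexp =
    RConst nat
  | RCell name nexp
  | RPlus rexp rexp
  | RMinus rexp rexp
  | RTimes rexp rexp
  | RDivide rexp rexp

datatype bexp =
    NLess nexp nexp
  | RLess rexp rexp
  | BNot bexp
  | BAnd bexp bexp

datatype com =
    Skip
  | NAssign name nexp nexp  \<comment> \<open>array, index, value\<close>
  | RAssign name nexp rexp
  | Seq com com
  | Cond bexp com com
  | While bexp com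

record state =
  nmem :: "name \<Rightarrow> nat \<Rightarrow> nat"
  rmem :: "name \<Rightarrow> nat \<Rightarrow> real"

primrec nval :: "nexp \<Rightarrow> state \<Rightarrow> nat" where
  "nval (NConst m) s = m"
| "nval (NCell x e) s = nmem s x (nval e s)"
| "nval (NPlus e f) s = nval e s + nval f s"
| "nval (NMinus e f) s = nval e s - nval f s"

primrec rval :: "rexp \<Rightarrow> state \<Rightarrow> real" where
  "rval (RConst m) s = real m"
| "rval (RCell x e) s = rmem s x (nval e s)"
| "rval (RPlus e f) s = rval e s + rval f s"
| "rval (RMinus e f) s = rval e s - rval f s"
| "rval (RTimes e f) s = rval e s * rval f s"
| "rval (RDivide e f) s = rval e s / rval f s"

primrec bval :: "bexp \<Rightarrow> state \<Rightarrow> bool" where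
  "bval (NLess e f) s \<longleftrightarrow> nval e s < nval f s"
| "bval (RLess e f) s \<longleftrightarrow> rval e s < rval f s"
| "bval (BNot b) s \<longleftrightarrow> \<not> bval b s"
| "bval (BAnd b d) s \<longleftrightarrow> bval b s \<and> bval d s"

primrec ntime :: "nexp \<Rightarrow> nat" where
  "ntime (NConst m) = 1"
| "ntime (NCell x e) = ntime e + 1"
| "ntime (NPlus e f) = ntime e + ntime f + 1"
| "ntime (NMinus e f) = ntime e + ntime f + 1"

primrec rtime :: "rexp \<Rightarrow> nat" where
  "rtime (RConst m) = 1"
| "rtime (RCell x e) = ntime e + 1"
| "rtime (RPlus e f) = rtime e + rtime f + 1"
| "rtime (RMinus e f) = rtime e + rtime f + 1"
| "rtime (RTimes e f) = rtime e + rtime f + 1"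
| "rtime (RDivide e f) = rtime e + rtime f + 1"

primrec btime :: "bexp \<Rightarrow> nat" where
  "btime (NLess e f) = ntime e + ntime f + 1"
| "btime (RLess e f) = rtime e + rtime f + 1"
| "btime (BNot b) = btime b + 1"
| "btime (BAnd b d) = btime b + btime d + 1"

definition nwrite :: "name \<Rightarrow> nat \<Rightarrow> nat \<Rightarrow> state \<Rightarrow> state" where
  "nwrite x i m s = s\<lparr>nmem := (nmem s)(x := (nmem s x)(i := m))\<rparr>"

definition rwrite :: "name \<Rightarrow> nat \<Rightarrow> real \<Rightarrow> state \<Rightarrow> state" where
  "rwrite x i a s = s\<lparr>rmem := (rmem s)(x := (rmem s x)(i := a))\<rparr>"

text \<open>\<open>exec P s t s'\<close>: started in \<open>s\<close>, \<open>P\<close> halts in \<open>s'\<close> after exactly \<open>t\<close> time units.\<close>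

inductive exec :: "com \<Rightarrow> state \<Rightarrow> nat \<Rightarrow> state \<Rightarrow> bool" where
  Skip: "exec Skip s 1 s"
| NAssign: "exec (NAssign x e f) s (ntime e + ntime f + 1) (nwrite x (nval e s) (nval f s) s)"
| RAssign: "exec (RAssign x e f) s (ntime e + rtime f + 1) (rwrite x (nval e s) (rval f s) s)"
| Seq: "exec P s t s' \<Longrightarrow> exec Q s' t' s'' \<Longrightarrow> exec (Seq P Q) s (t + t') s''"
| CondTrue: "bval b s \<Longrightarrow> exec P s t s' \<Longrightarrow> exec (Cond b P Q) s (btime b + 1 + t) s'"
| CondFalse: "\<not> bval b s \<Longrightarrow> exec Q s t s' \<Longrightarrow> exec (Cond b P Q) s (btime b + 1 + t) s'"
| WhileFalse: "\<not> bval b s \<Longrightarrow> exec (While b P) s (btime b + 1) s"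
| WhileTrue: "bval b s \<Longrightarrow> exec P s t s' \<Longrightarrow> exec (While b P) s' t' s'' \<Longrightarrow>
    exec (While b P) s (btime b + 1 + t + t') s''"

inductive_cases exec_SkipE: "exec Skip s t s'"
  and exec_NAssignE: "exec (NAssign x e f) s t s'"
  and exec_RAssignE: "exec (RAssign x e f) s t s'"
  and exec_SeqE: "exec (Seq P Q) s t s'"
  and exec_CondE: "exec (Cond b P Q) s t s'"
  and exec_WhileE: "exec (While b P) s t s'"

lemma exec_deterministic:
  "exec P s t s' \<Longrightarrow> exec P s u s'' \<Longrightarrow> u = t \<and> s'' = s'"
proof (induction arbitrary: u s'' rule: exec.induct)
  case (Skip s)
  then show ?case by (rule exec_SkipE) simp
next
  case (NAssign x e f s)
  then show ?case by (rule exec_NAssignE) simp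
next
  case (RAssign x e f s)
  then show ?case by (rule exec_RAssignE) simp
next
  case (Seq P s t s' Q t' r)
  from Seq.prems show ?case by (rule exec_SeqE) (auto dest!: Seq.IH)
next
  case (CondTrue b s P t s' Q)
  from CondTrue.prems show ?case
    by (rule exec_CondE) (auto simp: CondTrue.hyps dest!: CondTrue.IH)
next
  case (CondFalse b s Q t s' P)
  from CondFalse.prems show ?case
    by (rule exec_CondE) (auto simp: CondFalse.hyps dest!: CondFalse.IH)
next
  case (WhileFalse b s P)
  from WhileFalse.prems show ?case
    by (rule exec_WhileE) (auto simp: WhileFalse.hyps)
next
  case (WhileTrue b s P t s' t' r)
  from WhileTrue.prems show ?case
    by (rule exec_WhileE) (auto simp: WhileTrue.hyps dest!: WhileTrue.IH)
qed

section \<open>Input and output\<close>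

text \<open>
  The vertices of the instance are \<open>0, \<dots>, n - 1\<close>.  Costs and the adjacency matrix of \<open>A\<close> are stored
  row by row; every cell that does not hold input data is \<open>0\<close>, including the diagonal of the
  cost matrix.
\<close>

definition atsp_input ::
    "real \<Rightarrow> nat pair_pre_digraph \<Rightarrow> (nat \<times> nat) weight_fun \<Rightarrow> nat pair_pre_digraph \<Rightarrow> state" where
  "atsp_input \<beta> G c A = (let n = card (pverts G) in
     \<lparr>nmem = (\<lambda>x i.
        if x = ''n'' \<and> i = 0 then n
        else if x = ''A'' \<and> (i div n, i mod n) \<in> parcs A then 1
        else 0),
      rmem = (\<lambda>x i.
        if x = ''beta'' \<and> i = 0 then \<beta>
        else if x = ''c'' \<and> (i div n, i mod n) \<in> parcs G then c (i div n, i mod n)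
        else 0)\<rparr>)"

text \<open>The output is the cyclic sequence of the vertices in cells \<open>0, \<dots>, n - 1\<close> of an array.\<close>

definition tour_output :: "nat \<Rightarrow> state \<Rightarrow> (nat \<times> nat) awalk" where
  "tour_output n s = (let xs = map (nmem s ''tour'') [0..<n] in zip xs (rotate1 xs))"

end

theory Submission
  imports Defs
begin

text \<open>
  Delete from \<open>A\<close> the arcs \<open>(u, v)\<close> with \<open>\<beta> c(u, v) < c(v, u)\<close>; they are \<open>\<beta>\<close>-one-way, so at most
  \<open>k + 1\<close> trees remain.  A shortest tour through their roots is found by the Held--Karp recursion in
  \<open>O(2\<^sup>k k\<^sup>2)\<close> steps and costs at most \<open>c\<^sup>*(G)\<close>, by shortcutting an optimal tour.  Every other vertex
  \<open>v\<close> is then inserted right behind its parent \<open>p\<close> in the cyclic order; by the triangle inequality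
  this costs at most \<open>c(p, v) + c(v, p) \<le> (1 + \<beta>) c(p, v)\<close>.  All insertions together cost at most
  \<open>(1 + \<beta>) c(A) \<le> (1 + \<beta>) c\<^sup>*(G)\<close>, because an optimal tour minus an arc is a spanning arborescence.
\<close>

section \<open>Tours and arborescences\<close>

text \<open>The machine shapes the proof. Natural numbers can only be added and subtracted, so row
  offsets and powers of two are tabulated by repeated addition, and the bits of a set are found from
  the top by comparing and subtracting; this keeps the work per Held-Karp row quadratic in the
  number of roots. The bound \<open>k + 1\<close> on the number of trees comes from charging: a tree
  root other than the root of \<open>A\<close> is the head of a deleted arc. A kept arc satisfies
  \<open>c (v, u) \<le> \<beta> * c (u, v)\<close> without any quotient, which is where the factor
  \<open>1 + \<beta>\<close> arises. Costs are extended by 0 to the diagonal. If a single tree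
  remains, the tour through its root is a loop of cost 0, and neither Held-Karp nor the insertion
  treats this case separately. The partial tour is a successor map, so that an insertion is two
  assignments with a local effect on the cost. Optimality of Held-Karp splits in two: an entry is at
  most the cost of any order of the roots, and the tour read off the tables attains it.\<close>

lemma metric_atspD:
  assumes "metric_atsp G c"
  shows "finite (pverts G)"
    and "parcs G = {(u, v). u \<in> pverts G \<and> v \<in> pverts G \<and> u \<noteq> v}"
  using assms unfolding metric_atsp_def complete_digraph_pair_def by blast+

lemma metric_atsp_wf:
  assumes "metric_atsp G c"
  shows "pair_wf_digraph G"
  by unfold_locales (simp_all add: metric_atspD(2)[OF assms] case_prod_beta)

section \<open>Tours as cyclic lists of vertices\<close>

lemma pcas_vertices:
  "pcas u p v \<Longrightarrow> u # map snd p = map fst p @ [v]"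
  by (induction p arbitrary: u) auto

lemma pawalk_verts_vertices:
  "pcas u p v \<Longrightarrow> pawalk_verts u p = u # map snd p"
  by (induction p arbitrary: u) auto

lemma zip_walk:
  "pcas x (zip (x # ys) (ys @ [z])) z"
  by (induction ys arbitrary: x) auto

lemma set_zip_tl:
  "set (zip xs (tl xs)) = {(xs ! i, xs ! Suc i) |i. Suc i < length xs}"
  by (auto simp: set_zip nth_tl)

text \<open>A closed walk is determined by its tails, because its list of heads is that list rotated
  by one. With a single vertex the right-hand side would produce a loop, which is no arc.\<close>

lemma tour_eq_zip:
  assumes G: "metric_atsp G c" and n: "2 \<le> card (pverts G)"
  shows "tour G p \<longleftrightarrow> (\<exists>xs. distinct xs \<and> set xs = pverts G \<and> p = zip xs (rotate1 xs))"
    (is "_ \<longleftrightarrow> ?R")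
proof
  interpret pair_wf_digraph G by (rule metric_atsp_wf[OF G])
  assume t: "tour G p"
  then obtain u where u: "u \<in> pverts G" "set p \<subseteq> parcs G" "pcas u p u"
    "distinct (tl (pawalk_verts u p))" "p \<noteq> []" and V: "fst ` set p = pverts G"
    by (auto simp: tour_def cycle_def awalk_def)
  obtain e p' where p: "p = e # p'" using u(5) by (cases p) auto
  have eq: "u # map snd p = map fst p @ [u]" using pcas_vertices[OF u(3)] .
  then have snd: "map snd p = rotate1 (map fst p)"
    by (simp add: p)
  have "distinct (map snd p)"
    using u(4) pawalk_verts_vertices[OF u(3)] by simp
  then have "distinct (map fst p)" unfolding snd by simp
  moreover have "p = zip (map fst p) (rotate1 (map fst p))"
    unfolding snd[symmetric] by (simp add: zip_map_fst_snd)
  ultimately show ?R using V by (intro exI[of _ "map fst p"]) simp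
next
  interpret pair_wf_digraph G by (rule metric_atsp_wf[OF G])
  assume ?R
  then obtain xs where xs: "distinct xs" "set xs = pverts G" and p: "p = zip xs (rotate1 xs)" by blast
  have len: "2 \<le> length xs" using n xs by (metis distinct_card)
  then obtain x ys where x: "xs = x # ys" by (cases xs) auto
  have cas: "pcas x p x" using zip_walk[of x ys x] by (simp add: p x)
  have "p \<noteq> []" using len by (cases ys) (auto simp: p x)
  have "set p \<subseteq> parcs G"
  proof
    fix e assume "e \<in> set p"
    then obtain i where i: "i < length xs" "e = (xs ! i, xs ! (Suc i mod length xs))"
      by (auto simp: p set_zip nth_rotate1)
    have "Suc i mod length xs < length xs" using len by (intro mod_less_divisor) linarith
    moreover have "Suc i mod length xs \<noteq> i"
      using i len by (cases "Suc i = length xs") auto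
    ultimately show "e \<in> parcs G"
      using i xs(1) nth_mem[of _ xs] unfolding metric_atspD(2)[OF G] xs(2)[symmetric]
      by (simp add: nth_eq_iff_index_eq)
  qed
  moreover have "distinct (tl (pawalk_verts x p))"
    unfolding pawalk_verts_vertices[OF cas] using xs(1) by (simp add: p)
  ultimately have "cycle p"
    unfolding cycle_def awalk_def using \<open>p \<noteq> []\<close> cas xs(2) x by (metis list.set_intros(1))
  moreover have "map fst p = xs" by (simp add: p)
  then have "fst ` set p = pverts G" using xs by (metis list.set_map)
  ultimately show "tour G p" by (simp add: tour_def)
qed

text \<open>Makes the \<open>Min\<close> in \<open>opt_cost\<close> a genuine minimum.\<close>

lemma finite_tours:
  assumes G: "metric_atsp G c" and n: "2 \<le> card (pverts G)"
  shows "finite {p. tour G p}"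
proof -
  have "{p. tour G p} \<subseteq> (\<lambda>xs. zip xs (rotate1 xs)) ` {xs. set xs \<subseteq> pverts G \<and> length xs = card (pverts G)}"
    using tour_eq_zip[OF assms] distinct_card by fastforce
  then show ?thesis
    by (rule finite_subset) (use metric_atspD(1)[OF G] in \<open>simp add: finite_lists_length_eq\<close>)
qed

lemma optimal_tour:
  assumes G: "metric_atsp G c" and n: "2 \<le> card (pverts G)"
  obtains xs where "distinct xs" "set xs = pverts G" "opt_cost G c = tour_cost c (zip xs (rotate1 xs))"
proof -
  note tour = tour_eq_zip[OF assms]
  obtain xs where "set xs = pverts G" "distinct xs"
    using finite_distinct_list[OF metric_atspD(1)[OF G]] by auto
  then have "tour G (zip xs (rotate1 xs))" unfolding tour by auto
  then have "opt_cost G c \<in> tour_cost c ` {p. tour G p}"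
    unfolding opt_cost_def using finite_tours[OF assms] by (intro Min_in) auto
  then obtain p where "tour G p" and p: "opt_cost G c = tour_cost c p" by auto
  then obtain ys where "distinct ys" "set ys = pverts G" "p = zip ys (rotate1 ys)"
    unfolding tour by auto
  with p show thesis by (intro that) simp_all
qed

text \<open>The two neighbours on a cycle of its vertex furthest along the path coincide.\<close>

lemma path_no_long_cycle:
  assumes xs: "distinct xs"
    and T: "T = \<lparr>pverts = set xs, parcs = set (zip xs (tl xs))\<rparr>"
    and cyc: "pre_digraph.cycle (with_proj (mk_symmetric (with_proj T))) p"
  shows "length p < 3"
proof (rule ccontr)
  assume "\<not> length p < 3"
  then have len: "3 \<le> length p" by simp
  let ?S = "mk_symmetric (with_proj T)"
  interpret T: pair_wf_digraph T
    by unfold_locales (auto simp: T set_zip_tl)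
  interpret S: pair_wf_digraph ?S by (rule T.wellformed_mk_symmetric)
  obtain u where u: "set p \<subseteq> parcs ?S" "pcas u p u" "distinct (tl (pawalk_verts u p))" "p \<noteq> []"
    using cyc by (auto simp: S.cycle_def S.awalk_def)
  have snd: "map snd p = rotate1 (map fst p)"
    using pcas_vertices[OF u(2)] u(4) by (cases p) auto
  have dist: "distinct (map fst p)"
    using u(3) pawalk_verts_vertices[OF u(2)] snd by (metis distinct1_rotate list.sel(3))
  define L where "L = length p"
  define f where "f i = fst (p ! (i mod L))" for i
  have L: "3 \<le> L" "0 < L" using len by (auto simp: L_def)
  have arc: "p ! (i mod L) = (f i, f (Suc i))" for i
  proof -
    have "i mod L < L" using L by simp
    then have "snd (p ! (i mod L)) = rotate1 (map fst p) ! (i mod L)"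
      using snd by (metis L_def nth_map)
    also have "\<dots> = f (Suc i)"
      using \<open>i mod L < L\<close> L unfolding L_def
      by (subst nth_rotate1) (auto simp: f_def mod_Suc_eq L_def)
    finally show ?thesis by (simp add: f_def prod_eq_iff)
  qed
  have "\<exists>j < length xs. f i = xs ! j" for i
  proof -
    have "p ! (i mod L) \<in> parcs ?S" using u(1) L by (metis L_def mod_less_divisor nth_mem subsetD)
    then have "f i \<in> pverts ?S" using arc[of i] S.in_arcsD1 by metis
    then show ?thesis by (auto simp: T in_set_conv_nth)
  qed
  then obtain pos where pos: "pos i < length xs" "f i = xs ! pos i" for i by metis
  have step: "pos (Suc i) = Suc (pos i) \<or> pos i = Suc (pos (Suc i))" for i
  proof -
    have "p ! (i mod L) \<in> parcs ?S" using u(1) L by (metis L_def mod_less_divisor nth_mem subsetD)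
    then have "(f i, f (Suc i)) \<in> parcs T \<or> (f (Suc i), f i) \<in> parcs T"
      unfolding arc by (auto simp: parcs_mk_symmetric)
    then show ?thesis
      using pos[of i] pos[of "Suc i"] xs
      by (auto simp: T set_zip_tl nth_eq_iff_index_eq)
  qed
  have period: "pos (i + L) = pos i" for i
  proof -
    have "f (i + L) = f i" by (simp add: f_def)
    then show ?thesis using pos[of i] pos[of "i + L"] xs by (simp add: nth_eq_iff_index_eq)
  qed
  obtain m where m: "\<And>i. pos i \<le> pos m"
    using ex_has_greatest_nat[of "\<lambda>_. True" 0 pos "length xs"] pos less_imp_le by blast
  \<comment> \<open>\<open>l\<close> is the cyclic predecessor of \<open>m\<close>; adding
    \<open>L\<close> avoids a truncated subtraction at \<open>m = 0\<close>. Both neighbours of the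
    maximum must lie one position before it on the path.\<close>
  define l where "l = m + L - 1"
  have l: "Suc l = m + L" "Suc (Suc l) = Suc (m + L)" "Suc (Suc l) = Suc m + L"
    using L by (auto simp: l_def)
  have "pos (Suc m) = pos l"
    using step[of m] step[of l] m[of "Suc m"] m[of l] period[of m] l by auto
  then have "f (Suc m) = f l" using pos by metis
  then have "map fst p ! (Suc m mod L) = map fst p ! (l mod L)"
    using L by (simp add: f_def L_def)
  then have "Suc m mod L = l mod L"
    using dist L by (subst (asm) nth_eq_iff_index_eq) (auto simp: L_def)
  \<comment> \<open>Predecessor and successor of \<open>m\<close> are two steps apart on the cycle,
    so they coincide only if \<open>L\<close> divides 2.\<close>
  then have "(l + 2) mod L = l mod L" using l(3) by (metis add_2_eq_Suc' mod_add_self2)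
  then have "L dvd 2" by (metis add_diff_cancel_left' le_add1 mod_eq_dvd_iff_nat)
  then show False using L dvd_imp_le[of L 2] by simp
qed

lemma path_spanning_arborescence:
  assumes G: "metric_atsp G c" and xs: "distinct xs" "set xs = pverts G" "xs \<noteq> []"
  shows "spanning_arborescence G \<lparr>pverts = set xs, parcs = set (zip xs (tl xs))\<rparr>"
    (is "spanning_arborescence G ?T")
proof -
  interpret T: pair_wf_digraph ?T
    by unfold_locales (auto simp: set_zip_tl)
  interpret G: pair_wf_digraph G by (rule metric_atsp_wf[OF G])
  have root: "hd xs \<rightarrow>\<^sup>*\<^bsub>with_proj ?T\<^esub> v" if "v \<in> set xs" for v
  proof -
    have "xs ! 0 \<rightarrow>\<^sup>*\<^bsub>with_proj ?T\<^esub> xs ! i" if "i < length xs" for i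
      using that
    proof (induction i)
      case (Suc i)
      then have "(xs ! i, xs ! Suc i) \<in> parcs ?T" by (auto simp: set_zip_tl)
      then have "xs ! i \<rightarrow>\<^sup>*\<^bsub>with_proj ?T\<^esub> xs ! Suc i"
        by (intro T.reachable_adjI) (simp add: with_proj_simps)
      with Suc show ?case using T.reachable_trans by auto
    qed (use xs(3) in \<open>simp add: T.reachable_refl\<close>)
    then show ?thesis using that xs(3) by (auto simp: in_set_conv_nth hd_conv_nth)
  qed
  interpret S: pair_wf_digraph "mk_symmetric (with_proj ?T)" by (rule T.wellformed_mk_symmetric)
  have sym: "symmetric (with_proj (mk_symmetric (with_proj ?T)))"
    by (rule symmetric_mk_symmetric)
  have "connected (with_proj ?T)"
    unfolding connected_def strongly_connected_def
  proof (intro conjI ballI)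
    fix u v assume uv: "u \<in> verts (with_proj (mk_symmetric (with_proj ?T)))"
      "v \<in> verts (with_proj (mk_symmetric (with_proj ?T)))"
    \<comment> \<open>In the symmetric closure any two vertices are joined through the root: back to
      \<open>hd xs\<close> and forward again.\<close>
    have "hd xs \<rightarrow>\<^sup>*\<^bsub>mk_symmetric (with_proj ?T)\<^esub> u" "hd xs \<rightarrow>\<^sup>*\<^bsub>mk_symmetric (with_proj ?T)\<^esub> v"
      using uv root by (auto intro!: T.reachable_mk_symmetricI)
    then show "u \<rightarrow>\<^sup>*\<^bsub>mk_symmetric (with_proj ?T)\<^esub> v"
      using symmetric_reachable[OF sym] S.reachable_trans by blast
  qed (use xs(3) in simp)
  moreover have "(v, u) \<notin> parcs ?T" if "(u, v) \<in> parcs ?T" for u v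
    using that xs(1) by (auto simp: set_zip_tl nth_eq_iff_index_eq)
  ultimately have "directed_tree ?T"
    unfolding directed_tree_def using path_no_long_cycle[OF xs(1) refl] not_less by blast
  moreover have "set (zip xs (tl xs)) \<subseteq> parcs G"
    unfolding metric_atspD(2)[OF G] xs(2)[symmetric] using xs(1)
    by (auto simp: set_zip_tl nth_eq_iff_index_eq)
  then have "spanning (with_proj ?T) (with_proj G)"
    using xs(2) T.wf_digraph_axioms G.wf_digraph_axioms
    by (auto simp: spanning_def subgraph_def compatible_def)
  ultimately show ?thesis
    unfolding spanning_arborescence_def using root xs(3)
    by (auto intro!: bexI[of _ "hd xs"])
qed

section \<open>Acyclicity and in-arcs of a spanning arborescence\<close>

lemma spanning_arborescence_subset:
  assumes "spanning_arborescence G A"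
  shows "pverts A = pverts G" "parcs A \<subseteq> parcs G" "pair_wf_digraph A"
  using assms by (auto simp: spanning_arborescence_def spanning_def subgraph_def wf_digraph_wp_iff)

text \<open>A directed cycle is also a cycle of the symmetric closure, so it has at most two arcs.
  It is then a loop or an antiparallel pair, and a loop counts as antiparallel to itself.\<close>

lemma directed_tree_acyclic:
  assumes "directed_tree T" and wf: "pair_wf_digraph T"
  shows "acyclic (parcs T)"
proof (rule acyclicI, intro allI notI)
  fix v assume "(v, v) \<in> (parcs T)\<^sup>+"
  interpret pair_wf_digraph T by (rule wf)
  interpret S: pair_wf_digraph "mk_symmetric (with_proj T)" by (rule wellformed_mk_symmetric)
  have "\<exists>p. closed_w p"
    using \<open>(v, v) \<in> _\<close> reachable1_awalk[of v v] by (auto simp: closed_w_def)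
  then obtain p where p: "cycle p" using closed_w_imp_cycle by blast
  then have "pre_digraph.cycle (with_proj (mk_symmetric (with_proj T))) p"
    by (auto simp: cycle_def S.cycle_def awalk_def S.awalk_def parcs_mk_symmetric)
  then have "length p < 3" using assms(1) by (auto simp: directed_tree_def not_le)
  moreover obtain u where u: "set p \<subseteq> parcs T" "pcas u p u" "p \<noteq> []"
    using p by (auto simp: cycle_def awalk_def)
  ultimately obtain e where "p = [e] \<or> (\<exists>e'. p = [e, e'])"
    by (auto simp: numeral_eq_Suc less_Suc_eq length_Suc_conv)
  then have "\<exists>x y. (x, y) \<in> parcs T \<and> (y, x) \<in> parcs T"
    using u by (metis pcas.simps insert_subset list.simps(15) prod.collapse)
  then show False using assms(1) by (auto simp: directed_tree_def)
qed

text \<open>The last arc of a walk from the root enters \<open>v\<close>. This is what allows tree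
  roots to be charged to deleted arcs.\<close>

lemma spanning_arborescence_in_arc:
  assumes "spanning_arborescence G A"
  obtains r where "r \<in> pverts A" "\<And>v. v \<in> pverts A \<Longrightarrow> v \<noteq> r \<Longrightarrow> \<exists>u. (u, v) \<in> parcs A"
proof -
  interpret pair_wf_digraph A by (rule spanning_arborescence_subset[OF assms])
  obtain r where r: "r \<in> pverts A" "\<And>v. v \<in> pverts A \<Longrightarrow> r \<rightarrow>\<^sup>*\<^bsub>with_proj A\<^esub> v"
    using assms by (auto simp: spanning_arborescence_def)
  have "\<exists>u. (u, v) \<in> parcs A" if "v \<in> pverts A" "v \<noteq> r" for v
    using r(2)[OF that(1)] that(2)
    by (auto simp: reachable_def elim: rtrancl_on.cases)
  with r that show thesis by blast
qed

section \<open>Walks, cyclic orders and lower bounds\<close>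

primrec walk_cost :: "('a \<times> 'a \<Rightarrow> real) \<Rightarrow> 'a \<Rightarrow> 'a list \<Rightarrow> real" where
  "walk_cost d x [] = 0"
| "walk_cost d x (y # ys) = d (x, y) + walk_cost d y ys"

lemma walk_cost_zip:
  "walk_cost d x (ys @ [z]) = sum_list (map d (zip (x # ys) (ys @ [z])))"
  by (induction ys arbitrary: x) auto

text \<open>Unlike in \<open>metric_atsp\<close>, the vertices may coincide, so that shortcuts and
  insertions need no case distinctions.\<close>

definition semimetric_on :: "'a set \<Rightarrow> ('a \<times> 'a \<Rightarrow> real) \<Rightarrow> bool" where
  "semimetric_on V d \<longleftrightarrow> (\<forall>u\<in>V. \<forall>v\<in>V. 0 \<le> d (u, v)) \<and>
     (\<forall>u\<in>V. \<forall>v\<in>V. \<forall>w\<in>V. d (u, w) \<le> d (u, v) + d (v, w))"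

text \<open>Each dropped vertex is bypassed by one triangle inequality. The fixed end
  \<open>z\<close> guarantees that a dropped vertex always has a successor to shortcut to.\<close>

lemma walk_cost_filter:
  assumes d: "semimetric_on V d"
  shows "insert x (insert z (set ys)) \<subseteq> V \<Longrightarrow>
    walk_cost d x (filter P ys @ [z]) \<le> walk_cost d x (ys @ [z])"
proof (induction ys arbitrary: x)
  case (Cons y ys)
  have "walk_cost d x us \<le> d (x, y) + walk_cost d y us" if "us \<noteq> []" "set us \<subseteq> V" for us
  proof (cases us)
    case (Cons u vs)
    then have "u \<in> V" using that by simp
    then have "d (x, u) \<le> d (x, y) + d (y, u)"
      using d Cons.prems unfolding semimetric_on_def by simp
    with Cons show ?thesis by simp
  qed (use that in simp)
  from this[of "filter P ys @ [z]"]
  have "walk_cost d x (filter P ys @ [z]) \<le> d (x, y) + walk_cost d y (filter P ys @ [z])"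
    using Cons.prems by auto
  moreover have "walk_cost d y (filter P ys @ [z]) \<le> walk_cost d y (ys @ [z])"
    using Cons by auto
  ultimately show ?case by auto
qed simp

text \<open>Iterating the successor map from any start lists the whole cycle; this is how
  \<open>write_tour\<close> produces the output.\<close>

lemma rotate1_eq_successors:
  assumes "map s xs = rotate1 xs" "xs \<noteq> []"
  shows "xs = map (\<lambda>i. (s ^^ i) (hd xs)) [0..<length xs]"
proof -
  have "xs ! i = (s ^^ i) (hd xs)" if "i < length xs" for i
    using that
  proof (induction i)
    case 0
    then show ?case using assms by (simp add: hd_conv_nth)
  next
    case (Suc i)
    then have "s (xs ! i) = rotate1 xs ! i" using assms(1) by (metis Suc_lessD nth_map)
    also have "\<dots> = xs ! Suc i" using Suc.prems by (simp add: nth_rotate1)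
    finally show ?case using Suc by simp
  qed
  then show ?thesis by (intro nth_equalityI) auto
qed

section \<open>Cyclic orders as successor maps\<close>

lemma rotate_to_front:
  assumes "x \<in> set xs"
  obtains k ys where "rotate k xs = x # ys"
  using assms by (metis append_Cons rotate_append split_list)

lemma rotate_successors:
  assumes "map s xs = rotate1 xs"
  shows "map s (rotate k xs) = rotate1 (rotate k xs)"
  by (metis assms rotate_map rotate1_rotate_swap)

text \<open>The witness list forces one single cycle, whereas a mere permutation of \<open>I\<close>
  could split into several. Outside \<open>I\<close> the map \<open>s\<close> is arbitrary.\<close>

definition cyclic_succ :: "'a set \<Rightarrow> ('a \<Rightarrow> 'a) \<Rightarrow> bool" where
  "cyclic_succ I s \<longleftrightarrow> (\<exists>xs. distinct xs \<and> set xs = I \<and> map s xs = rotate1 xs)"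

lemma cyclic_succE:
  assumes "cyclic_succ I s" "x \<in> I"
  obtains ys where "distinct (x # ys)" "set (x # ys) = I" "map s (x # ys) = ys @ [x]"
proof -
  obtain xs where xs: "distinct xs" "set xs = I" "map s xs = rotate1 xs"
    using assms(1) by (auto simp: cyclic_succ_def)
  obtain k ys where "rotate k xs = x # ys"
    using assms(2) xs(2) rotate_to_front by metis
  then show thesis
    using that[of ys] rotate_successors[OF xs(3), of k] xs(1,2)
    by (metis distinct_rotate rotate1.simps(2) set_rotate)
qed

lemma cyclic_succ_closed: "cyclic_succ I s \<Longrightarrow> x \<in> I \<Longrightarrow> s x \<in> I"
  unfolding cyclic_succ_def by (metis image_eqI list.set_map set_rotate1)

text \<open>Rotated so that \<open>x\<close> comes first, the order \<open>x # ys\<close> becomes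
  \<open>x # y # ys\<close>; only the values at \<open>x\<close> and \<open>y\<close>
  change.\<close>

lemma cyclic_succ_insert:
  assumes "cyclic_succ I s" "x \<in> I" "y \<notin> I"
  shows "cyclic_succ (insert y I) (s(y := s x, x := y))"
proof -
  obtain ys where ys: "distinct (x # ys)" "set (x # ys) = I" "map s (x # ys) = ys @ [x]"
    using cyclic_succE assms by metis
  define s' where "s' = s(y := s x, x := y)"
  have "x \<noteq> y" using assms by auto
  then have "s' x = y" "s' y = s x" by (simp_all add: s'_def)
  moreover have "map s' ys = map s ys"
    using ys assms by (auto simp: s'_def)
  ultimately have "map s' (x # y # ys) = rotate1 (x # y # ys)"
    using ys(3) by (simp del: map_eq_conv)
  moreover have "distinct (x # y # ys)" "set (x # y # ys) = insert y I"
    using ys assms by auto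
  ultimately show ?thesis unfolding cyclic_succ_def s'_def by blast
qed

lemma sum_list_cycle:
  assumes "distinct xs" "map s xs = rotate1 xs"
  shows "sum_list (map d (zip xs (rotate1 xs))) = (\<Sum>v\<in>set xs. d (v, s v))"
proof -
  have "map d (zip xs (rotate1 xs)) = map (\<lambda>v. d (v, s v)) xs"
    unfolding assms(2)[symmetric] by (simp add: zip_map2 zip_same_conv_map)
  then show ?thesis by (simp add: sum_list_distinct_conv_sum_set assms)
qed

text \<open>The arc from \<open>x\<close> to \<open>s x\<close> is replaced by two arcs through
  \<open>y\<close>. Bounding the second by the detour from \<open>y\<close> back over
  \<open>x\<close> cancels the cost of the removed arc and leaves a round trip between
  \<open>x\<close> and \<open>y\<close>.\<close>

lemma cycle_insert_cost:
  assumes d: "semimetric_on V d" and I: "cyclic_succ I s" "x \<in> I" "y \<notin> I" "insert y I \<subseteq> V" "finite I"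
  shows "(\<Sum>v\<in>insert y I. d (v, (s(y := s x, x := y)) v)) \<le>
    (\<Sum>v\<in>I. d (v, s v)) + (d (x, y) + d (y, x))"
proof -
  define s' where "s' = s(y := s x, x := y)"
  have "x \<noteq> y" using I by auto
  then have s': "s' x = y" "s' y = s x" by (simp_all add: s'_def)
  have "(\<Sum>v\<in>insert y I. d (v, s' v)) = d (y, s x) + (d (x, y) + (\<Sum>v\<in>I - {x}. d (v, s' v)))"
    using I by (simp add: sum.remove[of I x] s')
  also have "(\<Sum>v\<in>I - {x}. d (v, s' v)) = (\<Sum>v\<in>I - {x}. d (v, s v))"
    using I by (intro sum.cong) (auto simp: s'_def)
  also have "\<dots> = (\<Sum>v\<in>I. d (v, s v)) - d (x, s x)"
    using I by (simp add: sum.remove[of I x])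
  moreover have "s x \<in> V" using cyclic_succ_closed[OF I(1,2)] I(4) by auto
  then have "d (y, s x) \<le> d (y, x) + d (x, s x)"
    using d I unfolding semimetric_on_def by auto
  ultimately show ?thesis unfolding s'_def by simp
qed

lemma zip_snoc_last: "zip (x # ys) (ys @ [z]) = zip (x # ys) ys @ [(last (x # ys), z)]"
  by (induction ys arbitrary: x) auto

lemma min_spanning_arborescence_le_opt:
  assumes G: "metric_atsp G c" and n: "2 \<le> card (pverts G)" and A: "min_spanning_arborescence G c A"
  shows "sum c (parcs A) \<le> opt_cost G c"
proof -
  obtain xs where xs: "distinct xs" "set xs = pverts G"
    and opt: "opt_cost G c = tour_cost c (zip xs (rotate1 xs))"
    using optimal_tour[OF G n] by blast
  have "xs \<noteq> []" using xs n by auto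
  then obtain x ys where x: "xs = x # ys" by (cases xs) auto
  have "tour G (zip xs (rotate1 xs))" unfolding tour_eq_zip[OF G n] using xs by blast
  then have "set (zip xs (rotate1 xs)) \<subseteq> parcs G"
    by (auto simp: tour_def pre_digraph.cycle_def pre_digraph.awalk_def)
  then have last: "(last xs, x) \<in> parcs G" by (simp add: x zip_snoc_last del: last.simps zip_Cons_Cons)
  then have "0 \<le> c (last xs, x)" using G unfolding metric_atsp_def by blast
  have "sum c (parcs A) \<le> sum c (parcs \<lparr>pverts = set xs, parcs = set (zip xs (tl xs))\<rparr>)"
    using A path_spanning_arborescence[OF G xs \<open>xs \<noteq> []\<close>]
    unfolding min_spanning_arborescence_def by blast
  also have "\<dots> = sum c (set (zip xs (tl xs)))" by simp
  also have "\<dots> = sum_list (map c (zip xs (tl xs)))"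
    by (rule sum_list_distinct_conv_sum_set[OF distinct_zipI1[OF xs(1)], symmetric])
  also have "\<dots> \<le> opt_cost G c"
    using \<open>0 \<le> c (last xs, x)\<close> unfolding opt tour_cost_def
    by (simp add: x zip_snoc_last del: last.simps zip_Cons_Cons)
  finally show ?thesis .
qed

text \<open>The hypotheses force \<open>0 < c (v, u)\<close>, so the ratio is a genuine quotient and
  lies below \<open>1 / \<beta>\<close>. The product form is the test that the machine
  performs.\<close>

lemma beta_one_wayI:
  assumes "1 \<le> \<beta>" "0 \<le> c (u, v)" "\<beta> * c (u, v) < c (v, u)"
  shows "beta_one_way \<beta> c (u, v)"
proof -
  have "c (u, v) \<le> \<beta> * c (u, v)" using assms(1,2) by (simp add: mult_le_cancel_right1)
  then have "c (u, v) < c (v, u)" "0 < c (v, u)" using assms by linarith+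
  moreover have "c (u, v) / c (v, u) < 1 / \<beta>"
    using assms \<open>0 < c (v, u)\<close> by (simp add: field_simps)
  ultimately show ?thesis by (simp add: beta_one_way_def one_way_def beta_symmetric_def)
qed

lemma semimetric_on_cost:
  assumes G: "metric_atsp G c"
  shows "semimetric_on (pverts G) (\<lambda>e. if e \<in> parcs G then c e else 0)"
proof -
  have "0 \<le> c (u, v)" if "u \<in> pverts G" "v \<in> pverts G" "u \<noteq> v" for u v
    using G that metric_atspD(2)[OF G] unfolding metric_atsp_def by blast
  moreover have "c (u, w) \<le> c (u, v) + c (v, w)"
    if "u \<in> pverts G" "v \<in> pverts G" "w \<in> pverts G" "u \<noteq> v" "v \<noteq> w" "u \<noteq> w" for u v w
    using G that unfolding metric_atsp_def by blast
  ultimately show ?thesis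
    unfolding semimetric_on_def metric_atspD(2)[OF G] by fastforce
qed

text \<open>The rank is the number of proper ancestors; acyclicity makes the inclusion of ancestor
  sets along an arc strict. The bound \<open>card V\<close> limits the number of insertion
  rounds.\<close>

lemma acyclic_rank:
  assumes "finite V" "acyclic E" "E \<subseteq> V \<times> V"
  obtains h where "\<And>u v. (u, v) \<in> E \<Longrightarrow> h u < h v" "\<And>v. v \<in> V \<Longrightarrow> h v < card V"
proof -
  define anc where "anc v = {u. (u, v) \<in> E\<^sup>+}" for v
  have sub: "anc v \<subseteq> V" for v using trancl_subset_Sigma[OF assms(3)] by (auto simp: anc_def)
  then have fin: "finite (anc v)" for v using assms(1) finite_subset by blast
  have irrefl: "v \<notin> anc v" for v using assms(2) by (simp add: anc_def acyclic_def)
  have "card (anc u) < card (anc v)" if "(u, v) \<in> E" for u v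
  proof (rule psubset_card_mono[OF fin])
    have "anc u \<subseteq> anc v" "u \<in> anc v" using that by (auto simp: anc_def)
    then show "anc u \<subset> anc v" using irrefl by blast
  qed
  moreover have "card (anc v) < card V" if "v \<in> V" for v
    using that sub irrefl assms(1) by (intro psubset_card_mono) blast+
  ultimately show thesis using that[of "\<lambda>v. card (anc v)"] by blast
qed

lemma zip_rotate1:
  "length xs = length ys \<Longrightarrow> zip (rotate1 xs) (rotate1 ys) = rotate1 (zip xs ys)"
  by (cases xs; cases ys) auto

lemma zip_rotate:
  "length xs = length ys \<Longrightarrow> zip (rotate k xs) (rotate k ys) = rotate k (zip xs ys)"
  by (induction k) (auto simp: zip_rotate1)

text \<open>Rotating an optimal order does not change its cost, so the start can be prescribed. This
  matters because the Held-Karp tables are tied to one start vertex.\<close>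

lemma optimal_subtour:
  assumes G: "metric_atsp G c" and n: "2 \<le> card (pverts G)"
    and d: "d = (\<lambda>e. if e \<in> parcs G then c e else 0)"
    and R: "x \<in> R" "R \<subseteq> pverts G"
  obtains zs where "distinct (x # zs)" "set (x # zs) = R" "walk_cost d x (zs @ [x]) \<le> opt_cost G c"
proof -
  obtain xs where xs: "distinct xs" "set xs = pverts G"
    and opt: "opt_cost G c = tour_cost c (zip xs (rotate1 xs))"
    using optimal_tour[OF G n] by blast
  obtain k ys where ys: "rotate k xs = x # ys"
    using rotate_to_front[of x xs] R xs(2) by blast
  have "zip (x # ys) (rotate1 (x # ys)) = rotate k (zip xs (rotate1 xs))"
    unfolding ys[symmetric] by (simp add: rotate1_rotate_swap zip_rotate)
  then have zips: "zip (x # ys) (ys @ [x]) = rotate k (zip xs (rotate1 xs))" by simp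
  have "tour G (zip xs (rotate1 xs))" unfolding tour_eq_zip[OF G n] using xs by blast
  then have arcs: "set (zip xs (rotate1 xs)) \<subseteq> parcs G"
    by (auto simp: tour_def pre_digraph.cycle_def pre_digraph.awalk_def)
  have "walk_cost d x (ys @ [x]) = sum_list (map d (zip (x # ys) (ys @ [x])))"
    by (rule walk_cost_zip)
  also have "\<dots> = sum_list (map d (zip xs (rotate1 xs)))"
    unfolding zips using distinct_zipI1[OF xs(1), of "rotate1 xs"]
    by (simp add: sum_list_distinct_conv_sum_set)
  also have "\<dots> = opt_cost G c"
    unfolding opt tour_cost_def using arcs by (intro arg_cong[of _ _ sum_list] map_cong) (auto simp: d)
  finally have cost: "walk_cost d x (ys @ [x]) = opt_cost G c" .
  have V: "insert x (set ys) = pverts G" using arg_cong[OF ys, of set] xs(2) by simp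
  have "distinct (x # ys)" using xs(1) by (metis distinct_rotate ys)
  let ?zs = "filter (\<lambda>v. v \<in> R) ys"
  have "walk_cost d x (?zs @ [x]) \<le> walk_cost d x (ys @ [x])"
    by (rule walk_cost_filter[of "pverts G"]) (use semimetric_on_cost[OF G] V in \<open>auto simp: d\<close>)
  then show thesis
    using that[of ?zs] \<open>distinct (x # ys)\<close> R V cost by auto
qed

section \<open>The Held--Karp recursion\<close>

text \<open>
  The vertices are \<open>r 0, \<dots>, r k\<close>, and bit \<open>i\<close> of \<open>S\<close> stands for \<open>r i\<close> with \<open>i < k\<close>.  The entry \<open>g S j\<close> is
  the least cost of a walk from \<open>r j\<close> through all of \<open>S\<close> to the start \<open>r k\<close>, and \<open>a S j\<close> its first
  step.  The program scans the bits of \<open>S\<close> downwards; \<open>hk_cell\<close> with parameter \<open>h\<close> says that the entry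
  is correct as far as first steps \<open>i \<ge> h\<close> are concerned.
\<close>

definition hk_cell :: "('a \<times> 'a \<Rightarrow> real) \<Rightarrow> (nat \<Rightarrow> 'a) \<Rightarrow> nat \<Rightarrow> (nat \<Rightarrow> nat \<Rightarrow> real) \<Rightarrow>
    (nat \<Rightarrow> nat \<Rightarrow> nat) \<Rightarrow> nat \<Rightarrow> nat \<Rightarrow> nat \<Rightarrow> bool" where
  "hk_cell d r k g a h S j \<longleftrightarrow> ((\<exists>i\<ge>h. bit S i) \<longrightarrow>
     a S j < k \<and> bit S (a S j) \<and> g S j = d (r j, r (a S j)) + g (S - 2 ^ a S j) (a S j) \<and>
     (\<forall>i\<ge>h. bit S i \<longrightarrow> g S j \<le> d (r j, r i) + g (S - 2 ^ i) i))"

definition hk_rows :: "('a \<times> 'a \<Rightarrow> real) \<Rightarrow> (nat \<Rightarrow> 'a) \<Rightarrow> nat \<Rightarrow> (nat \<Rightarrow> nat \<Rightarrow> real) \<Rightarrow>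
    (nat \<Rightarrow> nat \<Rightarrow> nat) \<Rightarrow> nat \<Rightarrow> bool" where
  "hk_rows d r k g a m \<longleftrightarrow>
     (\<forall>S<m. \<forall>j\<le>k. if S = 0 then g S j = d (r j, r k) else hk_cell d r k g a 0 S j)"

section \<open>Natural numbers as sets of bits\<close>

lemma bit_nat_imp_less: "bit S i \<Longrightarrow> S < 2 ^ k \<Longrightarrow> i < k" for S :: nat
  by (metis bit_take_bit_iff take_bit_nat_eq_self_iff)

text \<open>No borrow occurs, since the subtracted power is itself one of the bits. Subtraction thus
  removes an element from a set.\<close>

lemma bit_minus_power:
  fixes S :: nat
  assumes "bit S i"
  shows "bit (S - 2 ^ i) j \<longleftrightarrow> bit S j \<and> j \<noteq> i" and "2 ^ i \<le> S"
proof -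
  have "S = set_bit i (unset_bit i S)"
    using assms by (intro bit_eqI) (auto simp: bit_simps)
  also have "\<dots> = unset_bit i S + 2 ^ i"
    by (simp add: set_bit_eq bit_simps)
  finally have S: "S = unset_bit i S + 2 ^ i" .
  then have "S - 2 ^ i = unset_bit i S" by linarith
  then show "bit (S - 2 ^ i) j \<longleftrightarrow> bit S j \<and> j \<noteq> i" by (auto simp: bit_simps)
  show "2 ^ i \<le> S" using S by linarith
qed

lemma bits_empty_iff: "{i. bit S i} = {} \<longleftrightarrow> S = 0" for S :: nat
  by (auto simp: bit_eq_iff)

text \<open>The lower-bound half of Held-Karp: \<open>js\<close> is an arbitrary order of the set
  \<open>S\<close>, and peeling off its first step leads to the row of the remaining set.\<close>

lemma hk_rows_le:
  assumes hk: "hk_rows d r k g a (2 ^ k)"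
  shows "distinct js \<Longrightarrow> set js = {i. bit S i} \<Longrightarrow> S < 2 ^ k \<Longrightarrow> j \<le> k \<Longrightarrow>
    g S j \<le> walk_cost d (r j) (map r js @ [r k])"
proof (induction js arbitrary: S j)
  case Nil
  then have "S = 0" using bits_empty_iff by force
  with Nil hk show ?case by (auto simp: hk_rows_def)
next
  case (Cons i js)
  have i: "bit S i" using Cons.prems(2) by auto
  then have "S \<noteq> 0" by (metis bit_0_eq bot_apply bot_bool_def)
  have "g S j \<le> d (r j, r i) + g (S - 2 ^ i) i"
  proof -
    have "hk_cell d r k g a 0 S j"
      using hk Cons.prems(3,4) \<open>S \<noteq> 0\<close> unfolding hk_rows_def by metis
    with i show ?thesis unfolding hk_cell_def by blast
  qed
  moreover have "set js = {l. bit (S - 2 ^ i) l}"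
    using Cons.prems(1,2) i by (auto simp: bit_minus_power)
  moreover have "i \<le> k" using bit_nat_imp_less[OF i Cons.prems(3)] by simp
  moreover have "S - 2 ^ i < 2 ^ k" using Cons.prems(3) by (rule le_less_trans[rotated]) simp
  ultimately show ?case
    using Cons.IH[of "S - 2 ^ i" i] Cons.prems(1) by simp
qed

text \<open>\<open>2 ^ k - 1\<close> has exactly the bits below \<open>k\<close>, so it stands for
  all vertices except the start \<open>r k\<close>. The inverse of \<open>r\<close> turns lists of
  vertices into lists of indices.\<close>

lemma hk_rows_start_le:
  assumes hk: "hk_rows d r k g a (2 ^ k)"
    and xs: "distinct (r k # xs)" "set (r k # xs) = r ` {..k}" and r: "inj_on r {..k}"
  shows "g (2 ^ k - 1) k \<le> walk_cost d (r k) (xs @ [r k])"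
proof -
  define js where "js = map (inv_into {..k} r) xs"
  have "map r js = xs"
    unfolding js_def map_map using xs(2) by (intro map_idI) (metis comp_apply f_inv_into_f insertCI list.simps(15))
  have "set xs = r ` {..k} - {r k}" using xs by auto
  also have "\<dots> = r ` {..<k}"
    using r by (auto simp: inj_on_def less_le)
  finally have "set js = inv_into {..k} r ` r ` {..<k}" by (simp add: js_def)
  also have "\<dots> = {..<k}"
    using r by (intro inv_into_image_cancel) auto
  finally have "set js = {i. bit (2 ^ k - 1 :: nat) i}"
    unfolding mask_eq_exp_minus_1[symmetric] by (auto simp: bit_mask_iff)
  moreover have "distinct js"
    using xs(1) distinct_map[of r js] unfolding \<open>map r js = xs\<close> by simp
  ultimately show ?thesis
    using hk_rows_le[OF hk, of js _ k] \<open>map r js = xs\<close> by auto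
qed

text \<open>Lets a single comparison decide whether the downward scan has already met a bit of
  \<open>S\<close>.\<close>

lemma take_bit_less_iff: "take_bit m S < S \<longleftrightarrow> (\<exists>l\<ge>m. bit S l)" for S :: nat
proof -
  have "take_bit m S = S \<longleftrightarrow> (\<forall>l\<ge>m. \<not> bit S l)"
  proof
    assume "take_bit m S = S"
    then show "\<forall>l\<ge>m. \<not> bit S l" by (metis bit_take_bit_iff not_le)
  next
    assume "\<forall>l\<ge>m. \<not> bit S l"
    then show "take_bit m S = S" by (intro bit_eqI) (meson bit_take_bit_iff not_le)
  qed
  moreover have "take_bit m S \<le> S" by (rule take_bit_nat_less_eq_self)
  ultimately show ?thesis by (metis order_le_less less_irrefl)
qed

text \<open>A bit test by comparison: once the higher bits are gone, bit \<open>i\<close> decides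
  whether the rest reaches \<open>2 ^ i\<close>.\<close>

lemma power_le_take_bit_iff: "2 ^ i \<le> take_bit (Suc i) S \<longleftrightarrow> bit S i" for S :: nat
  by (cases "bit S i") (simp_all add: take_bit_Suc_from_most not_le)

lemma take_bit_Suc_minus: "bit S i \<Longrightarrow> take_bit (Suc i) S - 2 ^ i = take_bit i S" for S :: nat
  by (simp add: take_bit_Suc_from_most)

lemma bit_minus_power_less: "bit S i \<Longrightarrow> S - 2 ^ i < S" for S :: nat
  using bit_minus_power(2)[of S i] by (intro diff_less) (auto intro: less_le_trans[of 0 "2 ^ i"])

text \<open>A cell depends on its own entry and on rows below \<open>S\<close> only, so writing
  other columns of row \<open>S\<close> does not disturb it.\<close>

lemma hk_cell_cong:
  assumes "g' S j = g S j" "a' S j = a S j" "\<And>S' l. S' < S \<Longrightarrow> l \<le> k \<Longrightarrow> g' S' l = g S' l" "S < 2 ^ k"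
  shows "hk_cell d r k g' a' h S j \<longleftrightarrow> hk_cell d r k g a h S j"
proof -
  have "g' (S - 2 ^ i) i = g (S - 2 ^ i) i" if "bit S i" for i
    using that assms(3)[of "S - 2 ^ i" i] bit_nat_imp_less[OF that assms(4)] bit_minus_power_less[OF that]
    by simp
  then show ?thesis unfolding hk_cell_def assms(1,2) by metis
qed

lemma hk_rows_cong:
  assumes "\<And>S l. S < m \<Longrightarrow> l \<le> k \<Longrightarrow> g' S l = g S l \<and> a' S l = a S l" "m \<le> 2 ^ k"
  shows "hk_rows d r k g' a' m \<longleftrightarrow> hk_rows d r k g a m"
proof -
  have "hk_cell d r k g' a' 0 S l \<longleftrightarrow> hk_cell d r k g a 0 S l" if "S < m" "l \<le> k" for S l
    by (rule hk_cell_cong) (use that assms in auto)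
  then show ?thesis unfolding hk_rows_def using assms(1) by auto
qed

lemma hk_cell_skip:
  assumes "hk_cell d r k g a (Suc i) S j" "\<not> bit S i"
  shows "hk_cell d r k g a i S j"
proof -
  have "l \<ge> Suc i" if "l \<ge> i" "bit S l" for l
    using that assms(2) by (metis Suc_leI le_neq_implies_less)
  then show ?thesis using assms(1) unfolding hk_cell_def by blast
qed

text \<open>Without a bit above \<open>i\<close> the hypothesis on the cell is vacuous and the old
  entry may be garbage, so \<open>h\<close> is taken unconditionally; otherwise it replaces the
  entry only if it is smaller.\<close>

lemma hk_cell_step:
  assumes cell: "hk_cell d r k g a (Suc i) S j" and i: "bit S i" "S < 2 ^ k"
    and h: "h = d (r j, r i) + g (S - 2 ^ i) i"
    and upd: "if (\<exists>l\<ge>Suc i. bit S l) \<and> \<not> h < g S j then g' S j = g S j \<and> a' S j = a S j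
      else g' S j = h \<and> a' S j = i"
    and lower: "\<And>S' l. S' < S \<Longrightarrow> l \<le> k \<Longrightarrow> g' S' l = g S' l"
  shows "hk_cell d r k g' a' i S j"
proof -
  have lower': "g' (S - 2 ^ l) l = g (S - 2 ^ l) l" "l < k" if "bit S l" for l
    using that lower[of "S - 2 ^ l" l] bit_nat_imp_less[OF that i(2)] bit_minus_power_less[OF that]
    by simp_all
  have le: "g' S j \<le> d (r j, r l) + g' (S - 2 ^ l) l" if "l \<ge> i" "bit S l" for l
  proof (cases "l = i")
    case True
    then show ?thesis using upd h lower'[OF i(1)] by (auto split: if_splits)
  next
    case False
    then have l: "l \<ge> Suc i" using that by simp
    then have "g S j \<le> d (r j, r l) + g (S - 2 ^ l) l"
      using cell that unfolding hk_cell_def by blast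
    then show ?thesis using upd lower'[OF that(2)] l that by (auto split: if_splits)
  qed
  moreover have "a' S j < k \<and> bit S (a' S j) \<and>
      g' S j = d (r j, r (a' S j)) + g' (S - 2 ^ a' S j) (a' S j)"
  proof (cases "(\<exists>l\<ge>Suc i. bit S l) \<and> \<not> h < g S j")
    case True
    then have "a S j < k \<and> bit S (a S j) \<and> g S j = d (r j, r (a S j)) + g (S - 2 ^ a S j) (a S j)"
      using cell unfolding hk_cell_def by blast
    then show ?thesis using upd True lower'[of "a S j"] by simp
  next
    case False
    then have "g' S j = h" "a' S j = i" using upd by auto
    then show ?thesis using lower'[OF i(1)] i h by simp
  qed
  ultimately show ?thesis unfolding hk_cell_def by blast
qed

text \<open>Invariant for reading a tour off the tables: \<open>zs\<close> has been visited after
  \<open>k\<close>, and \<open>S\<close> is still to come. The last visited vertex has no successor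
  yet, hence \<open>butlast\<close>. Cost so far plus table entry for the rest stays equal to the
  optimal value.\<close>

definition hk_trace :: "('a \<times> 'a \<Rightarrow> real) \<Rightarrow> (nat \<Rightarrow> 'a) \<Rightarrow> nat \<Rightarrow> (nat \<Rightarrow> nat \<Rightarrow> real) \<Rightarrow> nat list \<Rightarrow>
    nat \<Rightarrow> ('a \<Rightarrow> 'a) \<Rightarrow> bool" where
  "hk_trace d r k g zs S s \<longleftrightarrow> distinct zs \<and> set zs \<inter> {i. bit S i} = {} \<and>
     set zs \<union> {i. bit S i} = {..<k} \<and> map s (map r (butlast (k # zs))) = map r zs \<and>
     walk_cost d (r k) (map r zs) + g S (last (k # zs)) = g (2 ^ k - 1) k"

lemma walk_cost_snoc:
  "walk_cost d x (ys @ [z]) = walk_cost d x ys + d (last (x # ys), z)"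
  by (induction ys arbitrary: x) auto

lemma hk_trace_Nil: "hk_trace d r k g [] (2 ^ k - 1) s"
  unfolding hk_trace_def mask_eq_exp_minus_1[symmetric] by (auto simp: bit_mask_iff)

text \<open>\<open>zs\<close> and \<open>S\<close> partition the \<open>k\<close> indices, so a loop
  of exactly \<open>k\<close> rounds visits everything.\<close>

lemma hk_trace_length:
  assumes "hk_trace d r k g zs S s"
  shows "S = 0 \<longleftrightarrow> length zs = k"
proof -
  have zs: "distinct zs" "set zs \<union> {i. bit S i} = {..<k}" "set zs \<inter> {i. bit S i} = {}"
    using assms by (auto simp: hk_trace_def)
  then have "{i. bit S i} = {} \<longleftrightarrow> set zs = {..<k}" by auto
  also have "\<dots> \<longleftrightarrow> card (set zs) = k"
    using zs(2) by (metis card_lessThan card_subset_eq finite_lessThan sup_ge1)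
  finally show ?thesis using distinct_card[OF zs(1)] by (simp only: bits_empty_iff)
qed

lemma hk_trace_less: "hk_trace d r k g zs S s \<Longrightarrow> S < 2 ^ k"
  unfolding hk_trace_def
  by (metis (no_types, lifting) bit_take_bit_iff bit_eq_iff lessThan_iff mem_Collect_eq take_bit_nat_eq_self_iff UnI2)

lemma hk_trace_last: "hk_trace d r k g zs S s \<Longrightarrow> last (k # zs) \<le> k"
proof -
  assume "hk_trace d r k g zs S s"
  then have "set zs \<subseteq> {..<k}" unfolding hk_trace_def by blast
  moreover have "last (k # zs) \<in> set (k # zs)" by (rule last_in_set) simp
  ultimately show ?thesis by auto
qed

text \<open>The stored first step attains the entry with equality, which preserves the total. By
  injectivity of \<open>r\<close>, assigning the successor of \<open>r j\<close> leaves the earlier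
  successors intact.\<close>

lemma hk_trace_step:
  assumes hk: "hk_rows d r k g a (2 ^ k)" and r: "inj_on r {..k}"
    and tr: "hk_trace d r k g zs S s" and S: "S \<noteq> 0" and j: "j = last (k # zs)" and i: "i = a S j"
  shows "hk_trace d r k g (zs @ [i]) (S - 2 ^ i) (s(r j := r i))" and "i < k"
proof -
  have "S < 2 ^ k" "j \<le> k" using hk_trace_less[OF tr] hk_trace_last[OF tr] j by auto
  then have "hk_cell d r k g a 0 S j" using hk S unfolding hk_rows_def by metis
  moreover have "\<exists>i\<ge>0. bit S i" using S bits_empty_iff[of S] by auto
  ultimately have cell: "i < k" "bit S i" "g S j = d (r j, r i) + g (S - 2 ^ i) i"
    unfolding hk_cell_def i by blast+
  then show "i < k" by simp
  have zs: "distinct zs" "set zs \<inter> {i. bit S i} = {}" "set zs \<union> {i. bit S i} = {..<k}"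
    "map s (map r (butlast (k # zs))) = map r zs"
    "walk_cost d (r k) (map r zs) + g S j = g (2 ^ k - 1) k"
    using tr unfolding hk_trace_def j by auto
  have eq: "k # zs = butlast (k # zs) @ [j]" unfolding j by (rule append_butlast_last_id[symmetric]) simp
  have "distinct (k # zs)" using zs by auto
  then have "j \<notin> set (butlast (k # zs))" by (subst (asm) eq) simp
  moreover have "set (butlast (k # zs)) \<subseteq> {..k}"
  proof
    fix l assume "l \<in> set (butlast (k # zs))"
    then have "l \<in> set (k # zs)" by (rule in_set_butlastD)
    moreover have "set zs \<subseteq> {..<k}" using zs(3) by blast
    ultimately show "l \<in> {..k}" by auto
  qed
  ultimately have "r j \<notin> r ` set (butlast (k # zs))"
    using r \<open>j \<le> k\<close> unfolding inj_on_def by blast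
  then have "map (s(r j := r i)) (map r (butlast (k # zs))) = map r zs"
    unfolding zs(4)[symmetric] by (metis map_fun_upd set_map)
  moreover have "butlast (k # zs @ [i]) = butlast (k # zs) @ [j]"
    by (metis eq append_Cons butlast_snoc)
  ultimately have "map (s(r j := r i)) (map r (butlast (k # zs @ [i]))) = map r (zs @ [i])"
    by (simp del: butlast.simps)
  moreover have "walk_cost d (r k) (map r (zs @ [i])) + g (S - 2 ^ i) i = g (2 ^ k - 1) k"
    using zs(5) cell(3) last_map[of "k # zs" r] unfolding j
    by (simp add: walk_cost_snoc del: last.simps)
  moreover have "{l. bit (S - 2 ^ i) l} = {l. bit S l} - {i}"
    using bit_minus_power(1)[OF cell(2)] by blast
  moreover have "i \<notin> set zs" using cell(2) zs(2) by blast
  moreover have "set (zs @ [i]) \<union> ({l. bit S l} - {i}) = {..<k}"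
    "set (zs @ [i]) \<inter> ({l. bit S l} - {i}) = {}"
    unfolding zs(3)[symmetric] using cell(2) zs(2) by auto
  ultimately show "hk_trace d r k g (zs @ [i]) (S - 2 ^ i) (s(r j := r i))"
    unfolding hk_trace_def using zs(1) by (simp del: butlast.simps)
qed

text \<open>The remaining entry \<open>g 0 j\<close> is the cost of the closing arc. For
  \<open>k = 0\<close> this is the loop at \<open>r 0\<close>.\<close>

lemma hk_trace_finish:
  assumes hk: "hk_rows d r k g a (2 ^ k)" and r: "inj_on r {..k}"
    and tr: "hk_trace d r k g zs 0 s" and j: "j = last (k # zs)"
  shows "cyclic_succ (r ` {..k}) (s(r j := r k))"
    and "(\<Sum>v\<in>r ` {..k}. d (v, (s(r j := r k)) v)) = g (2 ^ k - 1) k"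
proof -
  let ?s = "s(r j := r k)"
  let ?xs = "map r (k # zs)"
  have "j \<le> k" using hk_trace_last[OF tr] j by auto
  have zs: "distinct zs" "set zs = {..<k}"
    "map s (map r (butlast (k # zs))) = map r zs"
    "walk_cost d (r k) (map r zs) + g 0 j = g (2 ^ k - 1) k"
    using tr unfolding hk_trace_def j by auto
  have eq: "k # zs = butlast (k # zs) @ [j]" unfolding j by (rule append_butlast_last_id[symmetric]) simp
  have dist: "distinct (k # zs)" using zs by auto
  then have "j \<notin> set (butlast (k # zs))" by (subst (asm) eq) simp
  moreover have "set (butlast (k # zs)) \<subseteq> {..k}"
  proof
    fix l assume "l \<in> set (butlast (k # zs))"
    then have "l \<in> set (k # zs)" by (rule in_set_butlastD)
    moreover have "set zs \<subseteq> {..<k}" using zs(2) by blast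
    ultimately show "l \<in> {..k}" by auto
  qed
  ultimately have "r j \<notin> r ` set (butlast (k # zs))"
    using r \<open>j \<le> k\<close> unfolding inj_on_def by blast
  then have "map ?s (map r (butlast (k # zs))) = map r zs"
    unfolding zs(3)[symmetric] by (metis map_fun_upd set_map)
  then have "map ?s (map r (butlast (k # zs) @ [j])) = map r zs @ [r k]"
    by (simp del: butlast.simps)
  then have cyc: "map ?s ?xs = rotate1 ?xs" by (simp del: butlast.simps flip: eq)
  have kzs: "set (k # zs) = {..k}"
    unfolding lessThan_Suc_atMost[symmetric] lessThan_Suc by (simp add: zs(2))
  then have set: "set ?xs = r ` {..k}" by (simp only: set_map)
  have dist': "distinct ?xs" unfolding distinct_map kzs using r dist by simp
  then show "cyclic_succ (r ` {..k}) ?s" unfolding cyclic_succ_def using set cyc by blast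
  have "(\<Sum>v\<in>r ` {..k}. d (v, ?s v)) = sum_list (map d (zip ?xs (rotate1 ?xs)))"
    unfolding sum_list_cycle[OF dist' cyc] set ..
  also have "\<dots> = walk_cost d (r k) (map r zs @ [r k])"
    by (simp add: walk_cost_zip)
  also have "\<dots> = g (2 ^ k - 1) k"
    using zs(4) hk \<open>j \<le> k\<close> j by (auto simp: walk_cost_snoc last_map hk_rows_def)
  finally show "(\<Sum>v\<in>r ` {..k}. d (v, ?s v)) = g (2 ^ k - 1) k" .
qed

section \<open>Weakest preconditions with running time\<close>

text \<open>Termination is part of the claim, and the postcondition sees the exact running time. One
  execution suffices because \<open>exec\<close> is deterministic.\<close>

definition wp :: "com \<Rightarrow> (nat \<Rightarrow> state \<Rightarrow> bool) \<Rightarrow> state \<Rightarrow> bool" where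
  "wp P Q s \<longleftrightarrow> (\<exists>t s'. exec P s t s' \<and> Q t s')"

lemma wp_mono: "wp P Q s \<Longrightarrow> (\<And>t s'. Q t s' \<Longrightarrow> Q' t s') \<Longrightarrow> wp P Q' s"
  by (auto simp: wp_def)

lemma wp_exec: "exec P s t s' \<Longrightarrow> wp P Q s \<longleftrightarrow> Q t s'"
  unfolding wp_def by (metis exec_deterministic)

lemma wp_Skip: "wp Skip Q s \<longleftrightarrow> Q 1 s"
  by (intro wp_exec exec.Skip)

lemma wp_NAssign:
  "wp (NAssign x e f) Q s \<longleftrightarrow> Q (ntime e + ntime f + 1) (nwrite x (nval e s) (nval f s) s)"
  by (intro wp_exec exec.NAssign)

lemma wp_RAssign:
  "wp (RAssign x e f) Q s \<longleftrightarrow> Q (ntime e + rtime f + 1) (rwrite x (nval e s) (rval f s) s)"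
  by (intro wp_exec exec.RAssign)

lemma wp_Seq: "wp (Seq P R) Q s \<longleftrightarrow> wp P (\<lambda>t s'. wp R (\<lambda>u. Q (t + u)) s') s"
  by (auto simp: wp_def intro: exec.Seq elim!: exec_SeqE)

lemma wp_Cond:
  "wp (Cond b P R) Q s \<longleftrightarrow> wp (if bval b s then P else R) (\<lambda>t. Q (btime b + 1 + t)) s"
proof -
  have "exec (Cond b P R) s t s' \<longleftrightarrow>
      (\<exists>u. t = btime b + 1 + u \<and> exec (if bval b s then P else R) s u s')" for t s'
    by (auto intro: exec.CondTrue[of b s P _ s' R, simplified]
        exec.CondFalse[of b s R _ s' P, simplified] elim!: exec_CondE)
  then show ?thesis unfolding wp_def by auto
qed

lemmas wp_simps = wp_Skip wp_NAssign wp_RAssign wp_Seq wp_Cond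

section \<open>Frames: arrays that a program cannot change\<close>

primrec nwrites :: "com \<Rightarrow> name set" where
  "nwrites Skip = {}"
| "nwrites (NAssign x e f) = {x}"
| "nwrites (RAssign x e f) = {}"
| "nwrites (Seq P Q) = nwrites P \<union> nwrites Q"
| "nwrites (Cond b P Q) = nwrites P \<union> nwrites Q"
| "nwrites (While b P) = nwrites P"

primrec rwrites :: "com \<Rightarrow> name set" where
  "rwrites Skip = {}"
| "rwrites (NAssign x e f) = {}"
| "rwrites (RAssign x e f) = {x}"
| "rwrites (Seq P Q) = rwrites P \<union> rwrites Q"
| "rwrites (Cond b P Q) = rwrites P \<union> rwrites Q"
| "rwrites (While b P) = rwrites P"

definition frame :: "com \<Rightarrow> state \<Rightarrow> state \<Rightarrow> bool" where
  "frame P s s' \<longleftrightarrow> (\<forall>x. x \<notin> nwrites P \<longrightarrow> nmem s' x = nmem s x) \<and>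
                    (\<forall>x. x \<notin> rwrites P \<longrightarrow> rmem s' x = rmem s x)"

lemma frame_nmem: "frame P s s' \<Longrightarrow> x \<notin> nwrites P \<Longrightarrow> nmem s' x = nmem s x"
  and frame_rmem: "frame P s s' \<Longrightarrow> x \<notin> rwrites P \<Longrightarrow> rmem s' x = rmem s x"
  by (auto simp: frame_def)

lemma exec_frame: "exec P s t s' \<Longrightarrow> frame P s s'"
  by (induction rule: exec.induct) (auto simp: frame_def nwrite_def rwrite_def)

lemma wp_frame: "wp P Q s \<Longrightarrow> wp P (\<lambda>t s'. Q t s' \<and> frame P s s') s"
  by (auto simp: wp_def dest: exec_frame)

lemma nmem_nwrite: "nmem (nwrite x i m s) = (nmem s)(x := (nmem s x)(i := m))"
  and rmem_nwrite: "rmem (nwrite x i m s) = rmem s"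
  and nmem_rwrite: "nmem (rwrite x i a s) = nmem s"
  and rmem_rwrite: "rmem (rwrite x i a s) = (rmem s)(x := (rmem s x)(i := a))"
  by (simp_all add: nwrite_def rwrite_def)

lemmas mem_simps = nmem_nwrite rmem_nwrite nmem_rwrite rmem_rwrite

abbreviation nvar :: "name \<Rightarrow> nexp" where
  "nvar x \<equiv> NCell x (NConst 0)"

abbreviation nset :: "name \<Rightarrow> nexp \<Rightarrow> com" where
  "nset x \<equiv> NAssign x (NConst 0)"

definition for_less :: "name \<Rightarrow> nexp \<Rightarrow> com \<Rightarrow> com" where
  "for_less x e P = Seq (nset x (NConst 0))
     (While (NLess (nvar x) e) (Seq P (nset x (NPlus (nvar x) (NConst 1)))))"

lemma writes_for_less [simp]:
  "nwrites (for_less x e P) = insert x (nwrites P)"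
  "rwrites (for_less x e P) = rwrites P"
  by (auto simp: for_less_def)

text \<open>The invariant is indexed by the number of completed rounds, so \<open>N - m\<close>
  serves both as termination measure and as factor of the time bound.\<close>

lemma wp_while:
  assumes "I m s" "m \<le> N"
    and body: "\<And>m s. m < N \<Longrightarrow> I m s \<Longrightarrow> bval b s \<and> wp P (\<lambda>t s'. t \<le> B \<and> I (Suc m) s') s"
    and exit: "\<And>s. I N s \<Longrightarrow> \<not> bval b s"
  shows "wp (While b P) (\<lambda>t s'. t \<le> (N - m) * (B + btime b + 1) + btime b + 1 \<and> I N s') s"
  using assms(1,2)
proof (induction "N - m" arbitrary: m s)
  case 0
  then have "m = N" by simp
  with 0 have "\<not> bval b s" using exit by blast
  then show ?case
    unfolding wp_def using exec.WhileFalse 0 \<open>m = N\<close> by fastforce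
next
  case (Suc l)
  then have "m < N" by simp
  with Suc.prems body obtain t s' where b: "bval b s" and P: "exec P s t s'" "t \<le> B" "I (Suc m) s'"
    unfolding wp_def by blast
  have "wp (While b P) (\<lambda>t s'. t \<le> (N - Suc m) * (B + btime b + 1) + btime b + 1 \<and> I N s') s'"
    by (rule Suc.hyps) (use Suc.hyps \<open>m < N\<close> P in auto)
  then obtain u s'' where W: "exec (While b P) s' u s''"
    "u \<le> (N - Suc m) * (B + btime b + 1) + btime b + 1" "I N s''"
    unfolding wp_def by blast
  have eq: "N - m = Suc (N - Suc m)" using \<open>m < N\<close> by simp
  have "btime b + 1 + t + u \<le> (N - m) * (B + btime b + 1) + btime b + 1"
    using W(2) P(2) unfolding eq by simp
  then show ?case
    unfolding wp_def using exec.WhileTrue[OF b P(1) W(1)] W(3) by blast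
qed

text \<open>The bound \<open>e\<close> is evaluated anew in each round, so its value must stay
  \<open>N\<close>. The frame supplies facts about untouched memory, which keeps them out of the
  invariants. Of the 10 units per round, 6 pay for the increment and 4 for the test apart from
  \<open>e\<close>.\<close>

lemma wp_for_less:
  assumes init: "I 0 s"
    and idx: "\<And>m y s'. I m s' \<Longrightarrow> I m (nwrite x 0 y s')"
    and x: "x \<notin> nwrites P"
    and bound: "\<And>m s'. I m s' \<Longrightarrow> frame (for_less x e P) s s' \<Longrightarrow> nval e s' = N"
    and body: "\<And>m s'. m < N \<Longrightarrow> I m s' \<Longrightarrow> nmem s' x 0 = m \<Longrightarrow> frame (for_less x e P) s s' \<Longrightarrow>
      wp P (\<lambda>t s''. t \<le> B \<and> I (Suc m) s'') s'"
  shows "wp (for_less x e P) (\<lambda>t s'. t \<le> N * (B + ntime e + 10) + ntime e + 10 \<and> I N s') s"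
proof -
  let ?I = "\<lambda>m s'. I m s' \<and> nmem s' x 0 = m \<and> frame (for_less x e P) s s'"
  let ?b = "NLess (nvar x) e" and ?P = "Seq P (nset x (NPlus (nvar x) (NConst 1)))"
  have "wp (While ?b ?P) (\<lambda>t s'. t \<le> (N - 0) * (B + 6 + btime ?b + 1) + btime ?b + 1 \<and> ?I N s')
    (nwrite x 0 0 s)"
  proof (rule wp_while[where I = ?I])
    show "?I 0 (nwrite x 0 0 s)"
      using init idx by (auto simp: mem_simps frame_def)
  next
    fix m s' assume m: "m < N" and I: "?I m s'"
    have "wp P (\<lambda>t s''. (t \<le> B \<and> I (Suc m) s'') \<and> frame P s' s'') s'"
      using body m I by (intro wp_frame) auto
    then have "wp ?P (\<lambda>t s'. t \<le> B + 6 \<and> ?I (Suc m) s') s'"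
      unfolding wp_simps
      by (rule wp_mono) (use I x idx in \<open>auto simp: mem_simps frame_def\<close>)
    then show "bval ?b s' \<and> wp ?P (\<lambda>t s'. t \<le> B + 6 \<and> ?I (Suc m) s') s'"
      using m I bound[of m s'] by auto
  next
    show "\<not> bval ?b s'" if "?I N s'" for s'
      using that bound[of N s'] by auto
  qed simp
  then show ?thesis
    by (simp only: for_less_def wp_simps nval.simps)
      (erule wp_mono, auto simp: algebra_simps)
qed

lemma wpE:
  assumes "wp P Q s"
  obtains t s' where "exec P s t s'" "Q t s'" "frame P s s'"
  using assms exec_frame unfolding wp_def by blast

section \<open>Preprocessing and output\<close>

text \<open>Repeated addition stands in for the missing multiplication; afterwards each row offset
  of a matrix is one memory access.\<close>

definition multiples :: "name \<Rightarrow> name \<Rightarrow> name \<Rightarrow> com" where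
  "multiples x l e = Seq (nset ''y'' (NConst 0)) (for_less ''i'' (nvar l)
     (Seq (NAssign x (nvar ''i'') (nvar ''y'')) (nset ''y'' (NPlus (nvar ''y'') (nvar e)))))"

lemma wp_multiples:
  assumes "nmem s l 0 = N" "nmem s e 0 = D"
    and "distinct [x, l, e, ''i'', ''y''] \<or> l = e \<and> distinct [x, l, ''i'', ''y'']"
  shows "wp (multiples x l e) (\<lambda>t s'. t \<le> N * 30 + 20 \<and> (\<forall>i<N. nmem s' x i = i * D)) s"
  unfolding multiples_def wp_simps
  apply (rule wp_mono, rule wp_for_less[where N = N and B = 15 and
      I = "\<lambda>m s'. nmem s' ''y'' 0 = m * D \<and> (\<forall>i<m. nmem s' x i = i * D)"])
       apply (use assms in \<open>auto simp: mem_simps wp_simps frame_nmem less_Suc_eq\<close>)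
  done

definition read_cost :: "nexp \<Rightarrow> nexp \<Rightarrow> rexp" where
  "read_cost u v = RCell ''c'' (NPlus (NCell ''m'' u) v)"

text \<open>
  A flag \<open>q v = 1\<close> says that \<open>v\<close> is not yet on the tour; it is set if \<open>v\<close> has a parent \<open>p v\<close> and reset
  when \<open>v\<close> is inserted.
\<close>

definition keep_arcs :: com where
  "keep_arcs = for_less ''v'' (nvar ''n'') (for_less ''u'' (nvar ''n'')
     (Cond (BAnd (NLess (NConst 0) (NCell ''A'' (NPlus (NCell ''m'' (nvar ''u'')) (nvar ''v''))))
                 (BNot (RLess (RTimes (RCell ''beta'' (NConst 0)) (read_cost (nvar ''u'') (nvar ''v'')))
                              (read_cost (nvar ''v'') (nvar ''u'')))))
        (Seq (NAssign ''p'' (nvar ''v'') (nvar ''u'')) (NAssign ''q'' (nvar ''v'') (NConst 1)))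
        Skip))"

definition instance_at :: "nat \<Rightarrow> (nat \<times> nat \<Rightarrow> real) \<Rightarrow> state \<Rightarrow> bool" where
  "instance_at n d s \<longleftrightarrow> nmem s ''n'' 0 = n \<and> (\<forall>u<n. nmem s ''m'' u = u * n) \<and>
     (\<forall>u<n. \<forall>v<n. rmem s ''c'' (u * n + v) = d (u, v))"

definition kept_in_arc :: "(nat \<Rightarrow> nat \<Rightarrow> bool) \<Rightarrow> nat \<Rightarrow> nat \<Rightarrow> nat \<Rightarrow> state \<Rightarrow> bool" where
  "kept_in_arc K n m v s \<longleftrightarrow> nmem s ''q'' v = 1 \<and> nmem s ''p'' v < n \<and> K (nmem s ''p'' v) v \<or>
     nmem s ''q'' v = 0 \<and> (\<forall>u<m. \<not> K u v)"

lemma wp_keep_arcs: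
  assumes inst: "instance_at n d s"
    and A: "\<And>u v. u < n \<Longrightarrow> v < n \<Longrightarrow> 0 < nmem s ''A'' (u * n + v) \<longleftrightarrow> (u, v) \<in> E"
    and \<beta>: "rmem s ''beta'' 0 = \<beta>" and q: "nmem s ''q'' = (\<lambda>_. 0)"
    and K: "\<And>u v. K u v \<longleftrightarrow> (u, v) \<in> E \<and> \<not> \<beta> * d (u, v) < d (v, u)"
  shows "wp keep_arcs (\<lambda>t s'. t \<le> n * (n * 80 + 40) + 20 \<and> (\<forall>v<n. kept_in_arc K n n v s')) s"
  unfolding keep_arcs_def
proof (rule wp_mono, rule wp_for_less[where N = n and B = "n * 80 + 20" and
      I = "\<lambda>m s'. (\<forall>v<m. kept_in_arc K n n v s') \<and> (\<forall>v<n. m \<le> v \<longrightarrow> nmem s' ''q'' v = 0)"],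
      goal_cases)
  case (5 v s1)
  note fr1 = frame_nmem[OF 5(4)] frame_rmem[OF 5(4)]
  show ?case
  proof (rule wp_mono, rule wp_for_less[where N = n and B = 60 and
        I = "\<lambda>m s'. (\<forall>v'<v. kept_in_arc K n n v' s') \<and> kept_in_arc K n m v s' \<and>
           (\<forall>v'<n. v < v' \<longrightarrow> nmem s' ''q'' v' = 0)"],
        goal_cases)
    case 1
    then show ?case using 5 by (auto simp: kept_in_arc_def)
  next
    case (2 m y s2)
    then show ?case by (simp add: kept_in_arc_def mem_simps)
  next
    case (4 m s2)
    then show ?case using inst by (simp add: fr1 frame_nmem[OF 4(2)] instance_at_def)
  next
    case (5 u s2)
    note fr = fr1 frame_nmem[OF 5(4)] frame_rmem[OF 5(4)]
    have "u < n" "v < n" using 5 \<open>v < n\<close> by auto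
    then show ?case
      using 5 A[of u v] inst \<open>nmem s1 ''v'' 0 = v\<close>
      by (auto simp: wp_simps mem_simps fr instance_at_def read_cost_def \<beta> K kept_in_arc_def less_Suc_eq)
  next
    case (6 t s2)
    then show ?case by (auto simp: less_Suc_eq)
  qed auto
next
  case (6 t s1)
  then show ?case by (auto simp: algebra_simps)
qed (use inst q in \<open>auto simp: frame_nmem instance_at_def kept_in_arc_def mem_simps\<close>)

definition find_representatives :: com where
  "find_representatives = Seq (nset ''K'' (NConst 0)) (for_less ''v'' (nvar ''n'')
     (Cond (NLess (NCell ''q'' (nvar ''v'')) (NConst 1))
        (Seq (NAssign ''r'' (nvar ''K'') (nvar ''v'')) (nset ''K'' (NPlus (nvar ''K'') (NConst 1))))
        Skip))"

lemma wp_find_representatives: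
  assumes n: "nmem s ''n'' 0 = n"
  shows "wp find_representatives (\<lambda>t s'. t \<le> n * 50 + 20 \<and>
    map (nmem s' ''r'') [0..<nmem s' ''K'' 0] = filter (\<lambda>v. nmem s ''q'' v = 0) [0..<n]) s"
  unfolding find_representatives_def wp_simps
proof (rule wp_mono, rule wp_for_less[where N = n and B = 30 and
      I = "\<lambda>m s'. map (nmem s' ''r'') [0..<nmem s' ''K'' 0] = filter (\<lambda>v. nmem s ''q'' v = 0) [0..<m]"],
      goal_cases)
  case (5 v s1)
  note fr = frame_nmem[OF 5(4)]
  from 5 show ?case by (auto simp: wp_simps mem_simps fr)
qed (use n in \<open>auto simp: frame_nmem mem_simps\<close>)

definition write_tour :: com where
  "write_tour = Seq (nset ''v'' (NCell ''r'' (nvar ''k''))) (for_less ''i'' (nvar ''n'')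
     (Seq (NAssign ''tour'' (nvar ''i'') (nvar ''v'')) (nset ''v'' (NCell ''s'' (nvar ''v'')))))"

lemma wp_write_tour:
  assumes n: "nmem s ''n'' 0 = n"
  shows "wp write_tour (\<lambda>t s'. t \<le> n * 50 + 30 \<and>
    map (nmem s' ''tour'') [0..<n] = map (\<lambda>i. (nmem s ''s'' ^^ i) (nmem s ''r'' (nmem s ''k'' 0))) [0..<n]) s"
  unfolding write_tour_def wp_simps
proof (rule wp_mono, rule wp_for_less[where N = n and B = 30 and
      I = "\<lambda>m s'. (\<forall>i<m. nmem s' ''tour'' i = (nmem s ''s'' ^^ i) (nmem s ''r'' (nmem s ''k'' 0))) \<and>
        nmem s' ''v'' 0 = (nmem s ''s'' ^^ m) (nmem s ''r'' (nmem s ''k'' 0))"],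
      goal_cases)
  case (5 v s1)
  note fr = frame_nmem[OF 5(4)]
  from 5 show ?case by (auto simp: wp_simps mem_simps fr less_Suc_eq)
qed (use n in \<open>auto simp: frame_nmem mem_simps\<close>)

definition powers :: com where
  "powers = Seq (nset ''M'' (NConst 1)) (for_less ''i'' (nvar ''k'')
     (Seq (NAssign ''w'' (nvar ''i'') (nvar ''M'')) (nset ''M'' (NPlus (nvar ''M'') (nvar ''M'')))))"

lemma wp_powers:
  assumes "nmem s ''k'' 0 = k"
  shows "wp powers (\<lambda>t s'. t \<le> k * 40 + 20 \<and> nmem s' ''M'' 0 = 2 ^ k \<and> (\<forall>i<k. nmem s' ''w'' i = 2 ^ i)) s"
  unfolding powers_def wp_simps
proof (rule wp_mono, rule wp_for_less[where N = k and B = 25 and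
      I = "\<lambda>m s'. nmem s' ''M'' 0 = 2 ^ m \<and> (\<forall>i<m. nmem s' ''w'' i = 2 ^ i)"],
      goal_cases)
  case (5 v s1)
  then show ?case by (auto simp: wp_simps mem_simps less_Suc_eq)
qed (use assms in \<open>auto simp: frame_nmem mem_simps\<close>)

section \<open>Held--Karp on the machine\<close>

text \<open>Collects what Held-Karp reads but never writes, so that \<open>hk_ready_cong\<close>
  carries it through all loops.\<close>

definition hk_ready :: "nat \<Rightarrow> (nat \<times> nat \<Rightarrow> real) \<Rightarrow> nat \<Rightarrow> state \<Rightarrow> bool" where
  "hk_ready n d k s \<longleftrightarrow> instance_at n d s \<and> nmem s ''k'' 0 = k \<and> nmem s ''K'' 0 = Suc k \<and>
     nmem s ''M'' 0 = 2 ^ k \<and> (\<forall>i<k. nmem s ''w'' i = 2 ^ i) \<and>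
     (\<forall>S<2 ^ k. nmem s ''b'' S = S * Suc k) \<and> (\<forall>j\<le>k. nmem s ''r'' j < n)"

lemma hk_ready_cong:
  "(\<And>x. x \<in> {''n'', ''m'', ''k'', ''K'', ''M'', ''w'', ''b'', ''r''} \<Longrightarrow> nmem s' x = nmem s x) \<Longrightarrow>
    rmem s' ''c'' = rmem s ''c'' \<Longrightarrow> hk_ready n d k s' = hk_ready n d k s"
  by (simp add: hk_ready_def instance_at_def)

lemma hk_ready_read_cost:
  assumes "hk_ready n d k s" "nval e s \<le> k" "nval f s \<le> k"
  shows "rval (read_cost (NCell ''r'' e) (NCell ''r'' f)) s = d (nmem s ''r'' (nval e s), nmem s ''r'' (nval f s))"
  using assms by (simp add: hk_ready_def instance_at_def read_cost_def)

definition gtab :: "nat \<Rightarrow> state \<Rightarrow> nat \<Rightarrow> nat \<Rightarrow> real" where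
  "gtab k s S j = rmem s ''g'' (S * Suc k + j)"

definition atab :: "nat \<Rightarrow> state \<Rightarrow> nat \<Rightarrow> nat \<Rightarrow> nat" where
  "atab k s S j = nmem s ''a'' (S * Suc k + j)"

lemma table_index_eq_iff:
  assumes "j \<le> k" "l \<le> k"
  shows "S * Suc k + j = T * Suc k + l \<longleftrightarrow> S = T \<and> j = l"
proof
  assume eq: "S * Suc k + j = T * Suc k + l"
  have "S = (S * Suc k + j) div Suc k" "T = (T * Suc k + l) div Suc k"
    using assms by (simp_all del: mult_Suc_right)
  then have "S = T" using eq by metis
  then show "S = T \<and> j = l" using eq by simp
qed simp

text \<open>
  When bit \<open>i\<close> is processed, \<open>x\<close> holds \<open>S\<close> without the bits above \<open>i\<close>, so \<open>x < S\<close> tells that the cell has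
  been written before.
\<close>

definition relax :: com where
  "relax = Seq
     (RAssign ''h'' (NConst 0)
        (RPlus (read_cost (NCell ''r'' (nvar ''j'')) (NCell ''r'' (nvar ''i'')))
           (RCell ''g'' (NPlus (NCell ''b'' (NMinus (nvar ''S'') (NCell ''w'' (nvar ''i'')))) (nvar ''i'')))))
     (Cond (BAnd (NLess (nvar ''x'') (nvar ''S''))
              (BNot (RLess (RCell ''h'' (NConst 0)) (RCell ''g'' (NPlus (NCell ''b'' (nvar ''S'')) (nvar ''j''))))))
        Skip
        (Seq (RAssign ''g'' (NPlus (NCell ''b'' (nvar ''S'')) (nvar ''j'')) (RCell ''h'' (NConst 0)))
           (NAssign ''a'' (NPlus (NCell ''b'' (nvar ''S'')) (nvar ''j'')) (nvar ''i''))))"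

lemma wp_relax:
  assumes ready: "hk_ready n d k s"
    and mem: "nmem s ''S'' 0 = S" "nmem s ''i'' 0 = i" "nmem s ''j'' 0 = j" "nmem s ''x'' 0 = take_bit (Suc i) S"
    and S: "S < 2 ^ k" "bit S i" "j \<le> k"
    and cell: "hk_cell d (nmem s ''r'') k (gtab k s) (atab k s) (Suc i) S j"
  shows "wp relax (\<lambda>t s'. t \<le> 100 \<and> hk_cell d (nmem s ''r'') k (gtab k s') (atab k s') i S j \<and>
    (\<forall>T l. l \<le> k \<longrightarrow> (T, l) \<noteq> (S, j) \<longrightarrow> gtab k s' T l = gtab k s T l \<and> atab k s' T l = atab k s T l)) s"
proof -
  define h where "h = d (nmem s ''r'' j, nmem s ''r'' i) + gtab k s (S - 2 ^ i) i"
  have i: "i < k" "S - 2 ^ i < 2 ^ k"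
    using bit_nat_imp_less[OF S(2,1)] S(1) by auto
  have b: "nmem s ''b'' S = S * Suc k" "nmem s ''b'' (S - 2 ^ i) = (S - 2 ^ i) * Suc k" "nmem s ''w'' i = 2 ^ i"
    using ready S(1) i unfolding hk_ready_def by blast+
  define s1 where "s1 = rwrite ''h'' 0 h s"
  have rv: "rval (RPlus (read_cost (NCell ''r'' (nvar ''j'')) (NCell ''r'' (nvar ''i'')))
           (RCell ''g'' (NPlus (NCell ''b'' (NMinus (nvar ''S'') (NCell ''w'' (nvar ''i'')))) (nvar ''i'')))) s = h"
    using hk_ready_read_cost[OF ready, of "nvar ''j''" "nvar ''i''"] mem S(3) i b
    by (simp add: h_def gtab_def)
  define s2 where "s2 = nwrite ''a'' (S * Suc k + j) i (rwrite ''g'' (S * Suc k + j) h s1)"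
  have tabs: "gtab k s1 = gtab k s" "atab k s1 = atab k s"
    by (auto simp: gtab_def atab_def fun_eq_iff s1_def mem_simps)
  have tabs2: "gtab k s2 T l = (if T = S \<and> l = j then h else gtab k s T l)"
    "atab k s2 T l = (if T = S \<and> l = j then i else atab k s T l)" if "l \<le> k" for T l
    using table_index_eq_iff[OF that S(3), of T S]
    by (auto simp: gtab_def atab_def s2_def s1_def mem_simps simp del: mult_Suc_right)
  \<comment> \<open>\<open>u\<close> anticipates the final state: by
    \<open>take_bit_less_iff\<close> its guard agrees with the test \<open>x < S\<close> of the
    program.\<close>
  define u where "u = (if (\<exists>l\<ge>Suc i. bit S l) \<and> \<not> h < gtab k s S j then s1 else s2)"
  have "hk_cell d (nmem s ''r'') k (gtab k u) (atab k u) i S j"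
    by (rule hk_cell_step[OF cell S(2,1) h_def])
      (use S tabs tabs2 in \<open>auto simp: u_def\<close>)
  moreover have "\<forall>T l. l \<le> k \<longrightarrow> (T, l) \<noteq> (S, j) \<longrightarrow> gtab k u T l = gtab k s T l \<and> atab k u T l = atab k s T l"
    using tabs tabs2 by (auto simp: u_def)
  ultimately show ?thesis
    unfolding relax_def wp_simps rv
    using take_bit_less_iff[of "Suc i" S] mem b(1)
    by (auto simp: wp_simps mem_simps u_def s1_def s2_def gtab_def read_cost_def simp del: mult_Suc_right split: if_splits)
qed

lemma wp_relax_all:
  assumes ready: "hk_ready n d k s" and r: "nmem s ''r'' = r"
    and mem: "nmem s ''S'' 0 = S" "nmem s ''i'' 0 = i" "nmem s ''x'' 0 = take_bit (Suc i) S"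
    and S: "S < 2 ^ k" "bit S i"
    and cell: "\<forall>j\<le>k. hk_cell d r k (gtab k s) (atab k s) (Suc i) S j"
  shows "wp (for_less ''j'' (nvar ''K'') relax) (\<lambda>t s'. t \<le> Suc k * 120 + 20 \<and>
    (\<forall>j\<le>k. hk_cell d r k (gtab k s') (atab k s') i S j) \<and>
    (\<forall>T l. l \<le> k \<longrightarrow> T \<noteq> S \<longrightarrow> gtab k s' T l = gtab k s T l \<and> atab k s' T l = atab k s T l)) s"
\<comment> \<open>Columns below the counter have taken bit \<open>i\<close> into account, the others
  are still at level \<open>Suc i\<close>.\<close>
proof (rule wp_mono, rule wp_for_less[where N = "Suc k" and B = 100 and
      I = "\<lambda>m s'. (\<forall>j\<le>k. hk_cell d r k (gtab k s') (atab k s') (if j < m then i else Suc i) S j) \<and>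
        (\<forall>T l. l \<le> k \<longrightarrow> T \<noteq> S \<longrightarrow> gtab k s' T l = gtab k s T l \<and> atab k s' T l = atab k s T l)"],
      goal_cases)
  case (2 m y s')
  have "gtab k (nwrite ''j'' 0 y s') = gtab k s'" "atab k (nwrite ''j'' 0 y s') = atab k s'"
    by (auto simp: gtab_def atab_def fun_eq_iff mem_simps)
  then show ?case using 2 by simp
next
  case (4 m s')
  then show ?case using ready by (simp add: frame_nmem relax_def hk_ready_def)
next
  case (5 j s')
  note fr = frame_nmem[OF 5(4)] frame_rmem[OF 5(4)]
  have ready': "hk_ready n d k s'"
    using ready by (subst hk_ready_cong[of s' s]) (auto simp: fr relax_def)
  have mem': "nmem s' ''S'' 0 = S" "nmem s' ''i'' 0 = i" "nmem s' ''x'' 0 = take_bit (Suc i) S"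
    "nmem s' ''r'' = r"
    using mem r by (simp_all add: fr relax_def)
  have cell': "hk_cell d r k (gtab k s') (atab k s') (Suc i) S j" and "j \<le> k"
    using 5 by (auto dest!: spec[of _ j])
  show ?case
  proof (rule wp_mono, rule wp_relax[OF ready' mem'(1,2) 5(3) mem'(3) S \<open>j \<le> k\<close>], goal_cases)
    case 1
    then show ?case using cell' mem' by simp
  next
    case (2 t s'')
    have eq: "gtab k s'' T l = gtab k s' T l \<and> atab k s'' T l = atab k s' T l"
      if "l \<le> k" "T \<noteq> S \<or> l \<noteq> j" for T l
      using 2 that by auto
    have "hk_cell d r k (gtab k s'') (atab k s'') (if l < Suc j then i else Suc i) S l" if "l \<le> k" for l
    proof (cases "l = j")
      case True
      then show ?thesis using 2 mem' by simp
    next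
      case False
      have "hk_cell d r k (gtab k s'') (atab k s'') h S l \<longleftrightarrow> hk_cell d r k (gtab k s') (atab k s') h S l" for h
        by (rule hk_cell_cong) (use eq that False S(1) in auto)
      moreover have "l < Suc j \<longleftrightarrow> l < j" using False by auto
      ultimately show ?thesis using 5(2) that by simp
    qed
    with 2 eq 5(2) show ?case by auto
  qed
qed (use cell in \<open>auto simp: relax_def algebra_simps\<close>)

text \<open>Round \<open>z\<close> treats bit \<open>k - (z + 1)\<close>. The scan must go
  downwards, because comparing with \<open>2 ^ i\<close> reveals bit \<open>i\<close> only after the
  higher bits have been subtracted.\<close>

definition hk_row :: com where
  "hk_row = Seq (nset ''x'' (nvar ''S'')) (for_less ''z'' (nvar ''k'')
     (Seq (nset ''i'' (NMinus (nvar ''k'') (NPlus (nvar ''z'') (NConst 1))))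
        (Cond (NLess (nvar ''x'') (NCell ''w'' (nvar ''i''))) Skip
           (Seq (for_less ''j'' (nvar ''K'') relax)
              (nset ''x'' (NMinus (nvar ''x'') (NCell ''w'' (nvar ''i''))))))))"

lemma tabs_nwrite:
  "x \<noteq> ''a'' \<Longrightarrow> atab k (nwrite x i y s) = atab k s"
  "gtab k (nwrite x i y s) = gtab k s"
  by (auto simp: gtab_def atab_def fun_eq_iff mem_simps)

lemma wp_hk_row:
  assumes ready: "hk_ready n d k s" and r: "nmem s ''r'' = r"
    and mem: "nmem s ''S'' 0 = S" and S: "S < 2 ^ k" "S \<noteq> 0"
    and rows: "hk_rows d r k (gtab k s) (atab k s) S"
  shows "wp hk_row (\<lambda>t s'. t \<le> k * (Suc k * 120 + 90) + 20 \<and>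
    hk_rows d r k (gtab k s') (atab k s') (Suc S)) s"
  unfolding hk_row_def wp_simps
proof (rule wp_mono, rule wp_for_less[where N = k and B = "Suc k * 120 + 60" and
      I = "\<lambda>m s'. nmem s' ''x'' 0 = take_bit (k - m) S \<and>
        (\<forall>j\<le>k. hk_cell d r k (gtab k s') (atab k s') (k - m) S j) \<and>
        (\<forall>T l. l \<le> k \<longrightarrow> T \<noteq> S \<longrightarrow> gtab k s' T l = gtab k s T l \<and> atab k s' T l = atab k s T l)"],
      goal_cases)
  case 1
  \<comment> \<open>\<open>S\<close> has no bit from \<open>k\<close> on, so at level
    \<open>k\<close> the cells are vacuously correct although the row is still unwritten.\<close>
  have "\<not> bit S l" if "l \<ge> k" for l using bit_nat_imp_less[OF _ S(1)] that by (meson not_le)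
  moreover have "take_bit k S = S" using S(1) by (simp add: take_bit_nat_eq_self_iff)
  ultimately show ?case
    using mem by (auto simp: mem_simps tabs_nwrite hk_cell_def)
next
  case (2 m y s')
  then show ?case by (simp add: tabs_nwrite mem_simps)
next
  case (4 m s')
  then show ?case using ready by (simp add: frame_nmem relax_def hk_ready_def mem_simps)
next
  case (5 m s1)
  note fr = frame_nmem[OF 5(4)] frame_rmem[OF 5(4)]
  define i where "i = k - Suc m"
  have i: "Suc i = k - m" "i < k" using 5(1) by (auto simp: i_def)
  define s2 where "s2 = nwrite ''i'' 0 i s1"
  have mem2: "nmem s2 ''S'' 0 = S" "nmem s2 ''i'' 0 = i" "nmem s2 ''x'' 0 = take_bit (Suc i) S"
    "nmem s2 ''r'' = r" "nmem s2 ''w'' i = 2 ^ i"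
    using mem r 5(2) i ready by (simp_all add: s2_def mem_simps fr relax_def hk_ready_def)
  have k: "nmem s1 ''k'' 0 = k" using ready by (simp add: fr relax_def hk_ready_def mem_simps)
  have ready2: "hk_ready n d k s2"
    using ready by (subst hk_ready_cong[of s2 s]) (auto simp: s2_def mem_simps fr relax_def)
  have tab2: "gtab k s2 = gtab k s1" "atab k s2 = atab k s1" by (simp_all add: s2_def tabs_nwrite)
  show ?case
  proof (cases "bit S i")
    case True
    have "wp (for_less ''j'' (nvar ''K'') relax) (\<lambda>t s'. (t \<le> Suc k * 120 + 20 \<and>
      (\<forall>j\<le>k. hk_cell d r k (gtab k s') (atab k s') i S j) \<and>
      (\<forall>T l. l \<le> k \<longrightarrow> T \<noteq> S \<longrightarrow> gtab k s' T l = gtab k s2 T l \<and> atab k s' T l = atab k s2 T l)) \<and>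
      frame (for_less ''j'' (nvar ''K'') relax) s2 s') s2"
      by (rule wp_frame, rule wp_relax_all[OF ready2 mem2(4) mem2(1-3) S(1) True])
        (use 5(2) i tab2 in simp)
    then have body: "wp (Seq (for_less ''j'' (nvar ''K'') relax)
        (nset ''x'' (NMinus (nvar ''x'') (NCell ''w'' (nvar ''i''))))) (\<lambda>t s'. t \<le> Suc k * 120 + 30 \<and>
      nmem s' ''x'' 0 = take_bit i S \<and>
      (\<forall>j\<le>k. hk_cell d r k (gtab k s') (atab k s') i S j) \<and>
      (\<forall>T l. l \<le> k \<longrightarrow> T \<noteq> S \<longrightarrow> gtab k s' T l = gtab k s2 T l \<and> atab k s' T l = atab k s2 T l)) s2"
      unfolding wp_simps
    proof (rule wp_mono, goal_cases)
      case (1 t s3)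
      then have fr3: "frame (for_less ''j'' (nvar ''K'') relax) s2 s3" by blast
      have "nmem s3 ''x'' 0 = take_bit (Suc i) S" "nmem s3 ''i'' 0 = i" "nmem s3 ''w'' i = 2 ^ i"
        using mem2 by (simp_all add: frame_nmem[OF fr3] relax_def)
      with 1 show ?case
        by (simp add: mem_simps tabs_nwrite take_bit_Suc_minus[OF True])
    qed
    have "\<not> take_bit (Suc i) S < 2 ^ i" using power_le_take_bit_iff True by (simp add: not_less)
    then have "bval (NLess (nvar ''x'') (NCell ''w'' (nvar ''i''))) s2 = False"
      using mem2 by simp
    then show ?thesis
      unfolding wp_Seq wp_NAssign wp_Cond
      using k 5(3) 5(2) tab2 i
      by (simp flip: i_def s2_def wp_Seq wp_NAssign del: bval.simps)
        (rule wp_mono[OF body], auto)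
  next
    case False
    then have "take_bit (Suc i) S < 2 ^ i" using power_le_take_bit_iff by (simp add: not_le[symmetric])
    moreover have "take_bit (Suc i) S = take_bit i S" using False by (simp add: take_bit_Suc_from_most)
    moreover have "\<forall>j\<le>k. hk_cell d r k (gtab k s1) (atab k s1) i S j"
      using 5(2) hk_cell_skip[OF _ False] unfolding i(1)[symmetric] by blast
    ultimately show ?thesis
      using 5(2,3) k mem2 tab2 i by (simp add: wp_simps flip: i_def s2_def)
  qed
next
  case (6 t s')
  have "hk_rows d r k (gtab k s') (atab k s') S"
    using rows by (subst hk_rows_cong[where g = "gtab k s" and a = "atab k s"])
      (use 6 S in \<open>auto simp: tabs_nwrite\<close>)
  with 6 S show ?case by (auto simp: hk_rows_def less_Suc_eq algebra_simps)
qed (use ready in \<open>auto simp: relax_def\<close>)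

text \<open>Increasing numerical order refines inclusion: removing a bit gives a smaller number,
  whose row is already complete.\<close>

definition held_karp :: com where
  "held_karp = for_less ''S'' (nvar ''M'') (Cond (NLess (nvar ''S'') (NConst 1))
     (for_less ''j'' (nvar ''K'') (RAssign ''g'' (NPlus (NCell ''b'' (nvar ''S'')) (nvar ''j''))
        (read_cost (NCell ''r'' (nvar ''j'')) (NCell ''r'' (nvar ''k'')))))
     hk_row)"

lemma nwrites_hk: "nwrites hk_row = {''x'', ''z'', ''i'', ''j'', ''a''}" "rwrites hk_row = {''h'', ''g''}"
  by (auto simp: hk_row_def relax_def)

lemma nwrites_held_karp:
  "nwrites held_karp = {''S'', ''x'', ''z'', ''i'', ''j'', ''a''}" "rwrites held_karp = {''h'', ''g''}"
  by (auto simp: held_karp_def nwrites_hk)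

lemma wp_held_karp:
  assumes ready: "hk_ready n d k s" and r: "nmem s ''r'' = r"
  shows "wp held_karp (\<lambda>t s'. t \<le> 2 ^ k * (Suc k * (Suc k * 120 + 90) + 60) + 20 \<and>
    hk_rows d r k (gtab k s') (atab k s') (2 ^ k)) s"
  unfolding held_karp_def
proof (rule wp_mono, rule wp_for_less[where N = "2 ^ k" and B = "Suc k * (Suc k * 120 + 90) + 40" and
      I = "\<lambda>m s'. hk_rows d r k (gtab k s') (atab k s') m"], goal_cases)
  case (2 m y s')
  then show ?case by (simp add: tabs_nwrite)
next
  case (4 m s')
  then show ?case using ready by (simp add: frame_nmem hk_ready_def nwrites_hk)
next
  case (5 S s1)
  note fr = frame_nmem[OF 5(4)] frame_rmem[OF 5(4)]
  have ready1: "hk_ready n d k s1"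
    using ready by (subst hk_ready_cong[of s1 s]) (auto simp: fr nwrites_hk)
  have r1: "nmem s1 ''r'' = r" using r by (simp add: fr nwrites_hk)
  show ?case
  proof (cases "S = 0")
    case True
    have "wp (for_less ''j'' (nvar ''K'') (RAssign ''g'' (NPlus (NCell ''b'' (nvar ''S'')) (nvar ''j''))
        (read_cost (NCell ''r'' (nvar ''j'')) (NCell ''r'' (nvar ''k'')))))
      (\<lambda>t s'. t \<le> Suc k * 60 + 20 \<and> (\<forall>j\<le>k. gtab k s' 0 j = d (r j, r k))) s1"
    proof (rule wp_mono, rule wp_for_less[where N = "Suc k" and B = 40 and
          I = "\<lambda>m s'. \<forall>j<m. gtab k s' 0 j = d (r j, r k)"], goal_cases)
      case (4 m s')
      then show ?case using ready1 by (simp add: frame_nmem hk_ready_def)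
    next
      case (5 j s2)
      note fr2 = frame_nmem[OF 5(4)] frame_rmem[OF 5(4)]
      have ready2: "hk_ready n d k s2"
        using ready1 by (subst hk_ready_cong[of s2 s1]) (auto simp: fr2)
      have mem2: "nmem s2 ''r'' = r" "nmem s2 ''k'' 0 = k" "nmem s2 ''b'' 0 = 0" "nmem s2 ''S'' 0 = 0"
        using ready2 \<open>nmem s1 ''S'' 0 = S\<close> True r1
        by (auto simp: hk_ready_def fr2)
      have "rval (read_cost (NCell ''r'' (nvar ''j'')) (NCell ''r'' (nvar ''k''))) s2 = d (r j, r k)"
        using hk_ready_read_cost[OF ready2, of "nvar ''j''" "nvar ''k''"] 5(1,3) mem2 by simp
      then show ?case
        using 5(2,3) mem2 by (auto simp: wp_simps mem_simps gtab_def read_cost_def less_Suc_eq)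
    qed (auto simp: tabs_nwrite)
    then show ?thesis
      unfolding wp_Cond using 5(3) True
      by (simp only: bval.simps nval.simps if_True zero_less_one)
        (erule wp_mono, auto simp: hk_rows_def algebra_simps)
  next
    case False
    have "wp hk_row (\<lambda>t s'. t \<le> k * (Suc k * 120 + 90) + 20 \<and>
      hk_rows d r k (gtab k s') (atab k s') (Suc S)) s1"
      by (rule wp_hk_row[OF ready1 r1 5(3) _ False 5(2)]) (use 5(1) in simp)
    then show ?thesis
      unfolding wp_Cond using 5(3) False
      by (simp only: bval.simps nval.simps less_one if_False) (erule wp_mono, auto)
  qed
next
  case (6 t s')
  then show ?case by (auto simp: algebra_simps)
qed (use ready in \<open>auto simp: nwrites_hk hk_rows_def\<close>)

definition follow_hk :: com where
  "follow_hk = Seq (nset ''S'' (NMinus (nvar ''M'') (NConst 1))) (Seq (nset ''j'' (nvar ''k''))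
     (Seq (for_less ''z'' (nvar ''k'')
       (Seq (nset ''i'' (NCell ''a'' (NPlus (NCell ''b'' (nvar ''S'')) (nvar ''j''))))
       (Seq (NAssign ''s'' (NCell ''r'' (nvar ''j'')) (NCell ''r'' (nvar ''i'')))
       (Seq (nset ''S'' (NMinus (nvar ''S'') (NCell ''w'' (nvar ''i''))))
         (nset ''j'' (nvar ''i''))))))
     (NAssign ''s'' (NCell ''r'' (nvar ''j'')) (NCell ''r'' (nvar ''k'')))))"

lemma wp_follow_hk:
  assumes ready: "hk_ready n d k s" and r: "nmem s ''r'' = r" "inj_on r {..k}"
    and hk: "hk_rows d r k (gtab k s) (atab k s) (2 ^ k)"
  shows "wp follow_hk (\<lambda>t s'. t \<le> k * 80 + 60 \<and> cyclic_succ (r ` {..k}) (nmem s' ''s'') \<and>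
    (\<Sum>v\<in>r ` {..k}. d (v, nmem s' ''s'' v)) = gtab k s (2 ^ k - 1) k) s"
proof -
  let ?body = "Seq (nset ''i'' (NCell ''a'' (NPlus (NCell ''b'' (nvar ''S'')) (nvar ''j''))))
       (Seq (NAssign ''s'' (NCell ''r'' (nvar ''j'')) (NCell ''r'' (nvar ''i'')))
       (Seq (nset ''S'' (NMinus (nvar ''S'') (NCell ''w'' (nvar ''i''))))
         (nset ''j'' (nvar ''i''))))"
  let ?loop = "for_less ''z'' (nvar ''k'') ?body"
  define g where "g = gtab k s"
  \<comment> \<open>The list \<open>zs\<close> lives only in the invariant; the machine keeps the
    remaining set, the last index and the successor map.\<close>
  let ?I = "\<lambda>m s'. \<exists>zs. length zs = m \<and> hk_trace d r k g zs (nmem s' ''S'' 0) (nmem s' ''s'') \<and>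
    nmem s' ''j'' 0 = last (k # zs)"
  define s0 where "s0 = nwrite ''j'' 0 k (nwrite ''S'' 0 (2 ^ k - 1) s)"
  have mem: "nmem s ''M'' 0 = 2 ^ k" "nmem s ''k'' 0 = k" using ready by (simp_all add: hk_ready_def)
  have "wp ?loop (\<lambda>t s'. (t \<le> k * 70 + 20 \<and> ?I k s') \<and> frame ?loop s0 s') s0"
  proof (rule wp_frame, rule wp_mono, rule wp_for_less[where N = k and B = 50 and I = ?I], goal_cases)
    case 1
    show ?case using hk_trace_Nil[of d r k g] by (auto simp: s0_def mem_simps)
  next
    case (2 m y s')
    then show ?case by (simp add: mem_simps)
  next
    case (4 m s')
    then show ?case using mem by (simp add: frame_nmem s0_def mem_simps)
  next
    case (5 m s')
    note fr = frame_nmem[OF 5(4)] frame_rmem[OF 5(4)]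
    obtain zs where zs: "length zs = m" "hk_trace d r k g zs (nmem s' ''S'' 0) (nmem s' ''s'')"
      "nmem s' ''j'' 0 = last (k # zs)" using 5(2) by auto
    define S where "S = nmem s' ''S'' 0"
    define i where "i = atab k s S (last (k # zs))"
    have "S \<noteq> 0" "S < 2 ^ k" "last (k # zs) \<le> k"
      using hk_trace_length[OF zs(2)] hk_trace_less[OF zs(2)] hk_trace_last[OF zs(2)] zs(1) 5(1)
      by (auto simp: S_def simp del: last.simps)
    have step: "hk_trace d r k g (zs @ [i]) (S - 2 ^ i) ((nmem s' ''s'')(r (last (k # zs)) := r i))" "i < k"
      using hk_trace_step[OF hk[folded g_def] r(2) zs(2) _ refl, of i] \<open>S \<noteq> 0\<close>
      by (auto simp: i_def S_def)
    have mem': "nmem s' ''b'' S = S * Suc k" "nmem s' ''w'' i = 2 ^ i" "nmem s' ''r'' = r"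
      using ready r(1) \<open>S < 2 ^ k\<close> \<open>i < k\<close> by (simp_all add: fr s0_def mem_simps hk_ready_def)
    have "nmem s' ''a'' (S * Suc k + last (k # zs)) = i"
      by (simp add: fr s0_def mem_simps i_def atab_def)
    then have "wp ?body (\<lambda>t s''. t \<le> 50 \<and> nmem s'' ''S'' 0 = S - 2 ^ i \<and> nmem s'' ''j'' 0 = i \<and>
        nmem s'' ''s'' = (nmem s' ''s'')(r (last (k # zs)) := r i)) s'"
      using zs(3) mem' S_def by (simp add: wp_simps mem_simps del: last.simps mult_Suc_right)
    then show ?case
    proof (rule wp_mono, goal_cases)
      case (1 t s'')
      then show ?case using step(1) zs(1) by (auto intro!: exI[of _ "zs @ [i]"])
    qed
  next
    case (6 t s')
    then show ?case by auto
  qed auto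
  then have "wp (Seq ?loop (NAssign ''s'' (NCell ''r'' (nvar ''j'')) (NCell ''r'' (nvar ''k''))))
      (\<lambda>t s'. t \<le> k * 70 + 40 \<and> cyclic_succ (r ` {..k}) (nmem s' ''s'') \<and>
        (\<Sum>v\<in>r ` {..k}. d (v, nmem s' ''s'' v)) = gtab k s (2 ^ k - 1) k) s0"
    unfolding wp_Seq
  proof (rule wp_mono, goal_cases)
    case (1 t s')
    then have fr: "frame ?loop s0 s'" by blast
    obtain zs where zs: "length zs = k" "hk_trace d r k g zs (nmem s' ''S'' 0) (nmem s' ''s'')"
      "nmem s' ''j'' 0 = last (k # zs)" using 1 by auto
    have "nmem s' ''S'' 0 = 0" using hk_trace_length[OF zs(2)] zs(1) by simp
    with zs(2) have tr: "hk_trace d r k g zs 0 (nmem s' ''s'')" by simp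
    have mem': "nmem s' ''r'' = r" "nmem s' ''k'' 0 = k"
      using r mem by (simp_all add: frame_nmem[OF fr] s0_def mem_simps)
    show ?case
      using hk_trace_finish[OF hk[folded g_def] r(2) tr zs(3)] 1 mem'
      by (simp add: wp_simps mem_simps g_def)
  qed
  moreover have "nwrite ''j'' 0 k (nwrite ''S'' 0 (2 ^ k - Suc 0) s) = s0" by (simp add: s0_def)
  ultimately show ?thesis
    unfolding follow_hk_def wp_Seq[of "nset _ _"] wp_NAssign using mem
    by (simp add: mem_simps) (erule wp_mono, auto)
qed

section \<open>Inserting the remaining vertices\<close>

text \<open>Repeated sweeps replace a topological order: each one inserts the vertices whose parent
  is on the tour when they are reached, and \<open>n\<close> sweeps stay within quadratic
  time.\<close>

definition insert_vertices :: com where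
  "insert_vertices = for_less ''i'' (nvar ''n'') (for_less ''v'' (nvar ''n'')
     (Cond (BAnd (NLess (NConst 0) (NCell ''q'' (nvar ''v'')))
                 (NLess (NCell ''q'' (NCell ''p'' (nvar ''v''))) (NConst 1)))
        (Seq (NAssign ''s'' (nvar ''v'') (NCell ''s'' (NCell ''p'' (nvar ''v''))))
          (Seq (NAssign ''s'' (NCell ''p'' (nvar ''v'')) (nvar ''v''))
            (NAssign ''q'' (nvar ''v'') (NConst 0))))
        Skip))"

text \<open>\<open>B\<close> bounds the cost of the tour through the roots \<open>R\<close>; every
  vertex inserted since then pays for a round trip to its parent.\<close>

definition partial_tour :: "nat \<Rightarrow> (nat \<times> nat \<Rightarrow> real) \<Rightarrow> (nat \<Rightarrow> nat) \<Rightarrow> nat set \<Rightarrow> real \<Rightarrow> state \<Rightarrow> bool" where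
  "partial_tour n d p R B s \<longleftrightarrow> (let I = {v. v < n \<and> nmem s ''q'' v = 0} in
     R \<subseteq> I \<and> cyclic_succ I (nmem s ''s'') \<and>
     (\<Sum>v\<in>I. d (v, nmem s ''s'' v)) \<le> B + (\<Sum>v\<in>I - R. d (p v, v) + d (v, p v)))"

lemma partial_tour_insert:
  assumes d: "semimetric_on {0..<n} d" and s: "partial_tour n d p R B s"
    and v: "v < n" "nmem s ''q'' v \<noteq> 0" "p v < n" "nmem s ''q'' (p v) = 0"
    and s': "nmem s' ''q'' = (nmem s ''q'')(v := 0)"
      "nmem s' ''s'' = (nmem s ''s'')(v := nmem s ''s'' (p v), p v := v)"
  shows "partial_tour n d p R B s'"
proof -
  define I where "I = {v. v < n \<and> nmem s ''q'' v = 0}"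
  have I': "{v. v < n \<and> nmem s' ''q'' v = 0} = insert v I"
    using v by (auto simp: I_def s')
  have I: "R \<subseteq> I" "cyclic_succ I (nmem s ''s'')"
    "(\<Sum>v\<in>I. d (v, nmem s ''s'' v)) \<le> B + (\<Sum>v\<in>I - R. d (p v, v) + d (v, p v))"
    using s by (auto simp: partial_tour_def I_def Let_def)
  have v': "p v \<in> I" "v \<notin> I" "insert v I \<subseteq> {0..<n}" "finite I" using v by (auto simp: I_def)
  have "(\<Sum>u\<in>insert v I. d (u, nmem s' ''s'' u)) \<le>
      (\<Sum>u\<in>I. d (u, nmem s ''s'' u)) + (d (p v, v) + d (v, p v))"
    unfolding s' by (rule cycle_insert_cost[OF d I(2) v'])
  also have "\<dots> \<le> B + (\<Sum>u\<in>insert v (I - R). d (p u, u) + d (u, p u))"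
    using I(3) v' by simp
  also have "insert v (I - R) = insert v I - R" using v' I(1) by auto
  finally show ?thesis
    unfolding partial_tour_def I' Let_def
    using I(1) cyclic_succ_insert[OF I(2) v'(1,2)] by (auto simp: s'(2))
qed

text \<open>After \<open>i\<close> rounds all vertices of rank below \<open>i\<close> are on the tour.\<close>

lemma wp_insert_vertices:
  assumes d: "semimetric_on {0..<n} d" and n: "nmem s ''n'' 0 = n"
    and s: "partial_tour n d (nmem s ''p'') R B s"
    and p: "\<And>v. v < n \<Longrightarrow> nmem s ''q'' v \<noteq> 0 \<Longrightarrow> nmem s ''p'' v < n \<and> h (nmem s ''p'' v) < h v"
    and h: "\<And>v. v < n \<Longrightarrow> h v < n"
  shows "wp insert_vertices (\<lambda>t s'. t \<le> n * (n * 80 + 40) + 20 \<and> partial_tour n d (nmem s ''p'') R B s' \<and>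
    (\<forall>v<n. nmem s' ''q'' v = 0)) s"
  unfolding insert_vertices_def
proof (rule wp_mono, rule wp_for_less[where N = n and B = "n * 80 + 20" and
      I = "\<lambda>m s'. partial_tour n d (nmem s ''p'') R B s' \<and>
        (\<forall>v<n. nmem s' ''q'' v = 0 \<or> nmem s' ''q'' v = nmem s ''q'' v) \<and>
        (\<forall>v<n. h v < m \<longrightarrow> nmem s' ''q'' v = 0)"],
      goal_cases)
  case (5 m s1)
  note fr1 = frame_nmem[OF 5(4)] frame_rmem[OF 5(4)]
  show ?case
  proof (rule wp_mono, rule wp_for_less[where N = n and B = 60 and
        I = "\<lambda>i s'. partial_tour n d (nmem s ''p'') R B s' \<and>
        (\<forall>v<n. nmem s' ''q'' v = 0 \<or> nmem s' ''q'' v = nmem s ''q'' v) \<and>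
        (\<forall>v<n. h v < m \<or> h v = m \<and> v < i \<longrightarrow> nmem s' ''q'' v = 0)"],
        goal_cases)
    case 1
    then show ?case using 5 by auto
  next
    case (2 m y s2)
    then show ?case by (simp add: partial_tour_def mem_simps)
  next
    case (4 m s2)
    then show ?case using n by (simp add: fr1 frame_nmem[OF 4(2)])
  next
    case (5 v s2)
    note fr = fr1 frame_nmem[OF 5(4)] frame_rmem[OF 5(4)]
    have v: "v < n" "nmem s2 ''v'' 0 = v" using 5 by auto
    let ?p = "nmem s ''p''"
    note I = 5(2)
    have P: "nmem s2 ''p'' = ?p" by (simp add: fr)
    show ?case
    proof (cases "0 < nmem s2 ''q'' v \<and> nmem s2 ''q'' (?p v) = 0")
      case True
      then have pv: "?p v < n" using I p v by force
      define s3 where "s3 = nwrite ''q'' v 0 (nwrite ''s'' (?p v) v (nwrite ''s'' v (nmem s2 ''s'' (?p v)) s2))"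
      have "partial_tour n d ?p R B s3"
        by (rule partial_tour_insert[of n d ?p R B s2 v])
          (use d I v True pv in \<open>auto simp: s3_def mem_simps\<close>)
      moreover have "nmem s3 ''q'' = (nmem s2 ''q'')(v := 0)" by (simp add: s3_def mem_simps)
      ultimately show ?thesis
        using I True v by (simp add: wp_simps mem_simps P less_Suc_eq flip: s3_def)
    next
      case False
      \<comment> \<open>The parent of a vertex of rank \<open>m\<close> has smaller rank and is
        already on the tour, so the test can fail only because \<open>v\<close> is there
        too.\<close>
      have "nmem s2 ''q'' v = 0" if "h v = m"
        using that I p v False by force
      then show ?thesis
        using I False v by (auto simp: wp_simps P less_Suc_eq)
    qed
  next
    case (6 t s2)
    then show ?case by (auto simp: less_Suc_eq)
  qed auto
next
  case (6 t s1)
  then show ?case using h by (auto simp: algebra_simps)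
qed (use n s in \<open>auto simp: frame_nmem partial_tour_def mem_simps\<close>)

section \<open>The algorithm\<close>

definition atsp_program :: com where
  "atsp_program = Seq (multiples ''m'' ''n'' ''n'') (Seq keep_arcs (Seq find_representatives
     (Seq (nset ''k'' (NMinus (nvar ''K'') (NConst 1))) (Seq powers (Seq (multiples ''b'' ''M'' ''K'')
     (Seq held_karp (Seq follow_hk (Seq insert_vertices write_tour))))))))"

lemma writes:
  "nwrites (multiples x l e) = {''y'', ''i'', x}" "rwrites (multiples x l e) = {}"
  "nwrites keep_arcs = {''v'', ''u'', ''p'', ''q''}" "rwrites keep_arcs = {}"
  "nwrites find_representatives = {''K'', ''v'', ''r''}" "rwrites find_representatives = {}"
  "nwrites powers = {''M'', ''i'', ''w''}" "rwrites powers = {}"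
  "nwrites follow_hk = {''S'', ''j'', ''z'', ''i'', ''s''}" "rwrites follow_hk = {}"
  "nwrites insert_vertices = {''i'', ''v'', ''s'', ''q''}" "rwrites insert_vertices = {}"
  by (auto simp: multiples_def keep_arcs_def find_representatives_def powers_def follow_hk_def
      insert_vertices_def)

text \<open>Separates the machine from the graph theory: acyclicity enters only as the rank
  \<open>h\<close> along kept arcs \<open>K\<close>. The start \<open>x\<close> is chosen by the
  program, so the cost is compared with every order of \<open>R\<close> beginning there.\<close>

lemma wp_atsp_program:
  fixes K :: "nat \<Rightarrow> nat \<Rightarrow> bool"
  assumes n: "0 < n" and d: "semimetric_on {0..<n} d"
    and h: "\<And>u v. u < n \<Longrightarrow> v < n \<Longrightarrow> K u v \<Longrightarrow> h u < h v" "\<And>v. v < n \<Longrightarrow> h v < n"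
    and mem: "nmem s ''n'' 0 = n" "nmem s ''q'' = (\<lambda>_. 0)" "rmem s ''beta'' 0 = \<beta>"
      "\<And>u v. u < n \<Longrightarrow> v < n \<Longrightarrow> 0 < nmem s ''A'' (u * n + v) \<longleftrightarrow> (u, v) \<in> E"
      "\<And>u v. u < n \<Longrightarrow> v < n \<Longrightarrow> rmem s ''c'' (u * n + v) = d (u, v)"
    and K: "\<And>u v. K u v \<longleftrightarrow> (u, v) \<in> E \<and> \<not> \<beta> * d (u, v) < d (v, u)"
    and R: "R = {v. v < n \<and> (\<forall>u<n. \<not> K u v)}"
  shows "wp atsp_program (\<lambda>t s'. t \<le> 2000 * (2 ^ (card R - 1) * card R ^ 2 + n ^ 2) \<and>
    (\<exists>xs p x. map (nmem s' ''tour'') [0..<n] = xs \<and> distinct xs \<and> set xs = {0..<n} \<and> x \<in> R \<and>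
      (\<forall>v\<in>{0..<n} - R. p v < n \<and> K (p v) v) \<and>
      (\<forall>zs. distinct (x # zs) \<longrightarrow> set (x # zs) = R \<longrightarrow> sum_list (map d (zip xs (rotate1 xs))) \<le>
        walk_cost d x (zs @ [x]) + (\<Sum>v\<in>{0..<n} - R. d (p v, v) + d (v, p v))))) s"
proof -
  have "wp (multiples ''m'' ''n'' ''n'')
      (\<lambda>t s'. t \<le> n * 30 + 20 \<and> (\<forall>i<n. nmem s' ''m'' i = i * n)) s"
    by (rule wp_multiples) (use mem in auto)
  then obtain t1 s1 where e1: "exec (multiples ''m'' ''n'' ''n'') s t1 s1" and t1: "t1 \<le> n * 30 + 20"
    and m: "\<forall>i<n. nmem s1 ''m'' i = i * n" and f1: "frame (multiples ''m'' ''n'' ''n'') s s1"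
    by (elim wpE) blast
  note fr1 = frame_nmem[OF f1] frame_rmem[OF f1]
  have inst1: "instance_at n d s1" using m mem by (simp add: instance_at_def fr1 writes)
  have "wp keep_arcs (\<lambda>t s'. t \<le> n * (n * 80 + 40) + 20 \<and> (\<forall>v<n. kept_in_arc K n n v s')) s1"
    by (rule wp_keep_arcs[OF inst1 _ _ _ K]) (use mem in \<open>auto simp: fr1 writes\<close>)
  then obtain t2 s2 where e2: "exec keep_arcs s1 t2 s2" and t2: "t2 \<le> n * (n * 80 + 40) + 20"
    and kept: "\<forall>v<n. kept_in_arc K n n v s2" and f2: "frame keep_arcs s1 s2"
    by (elim wpE) blast
  note fr2 = frame_nmem[OF f2] frame_rmem[OF f2]
  have inst2: "instance_at n d s2" using inst1 by (simp add: instance_at_def fr2 writes)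
  define p where "p = nmem s2 ''p''"
  have qR: "nmem s2 ''q'' v = 0 \<longleftrightarrow> v \<in> R" if "v < n" for v
    using kept that by (force simp: kept_in_arc_def R)
  have p: "p v < n \<and> K (p v) v" if "v < n" "nmem s2 ''q'' v \<noteq> 0" for v
    using kept that by (auto simp: kept_in_arc_def p_def)
  have "finite R" by (simp add: R)
  have "R \<noteq> {}"
  proof -
    \<comment> \<open>A vertex of least rank has no kept in-arc.\<close>
    define v where "v = arg_min h (\<lambda>v. v < n)"
    have "v < n" "\<not> (\<exists>u<n. h u < h v)"
      using arg_min_nat_lemma[of "\<lambda>v. v < n" 0 h] n by (auto simp: v_def not_less)
    then have "v \<in> R" using h(1) by (auto simp: R)
    then show ?thesis by auto
  qed
  define k where "k = card R - 1"
  have k: "card R = Suc k" using \<open>finite R\<close> \<open>R \<noteq> {}\<close> by (simp add: k_def card_gt_0_iff)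
  have n2: "nmem s2 ''n'' 0 = n" using inst2 by (simp add: instance_at_def)
  obtain t3 s3 where e3: "exec find_representatives s2 t3 s3" and t3: "t3 \<le> n * 50 + 20"
    and reps: "map (nmem s3 ''r'') [0..<nmem s3 ''K'' 0] = filter (\<lambda>v. nmem s2 ''q'' v = 0) [0..<n]"
    and f3: "frame find_representatives s2 s3"
    using wp_find_representatives[OF n2] by (elim wpE) blast
  note fr3 = frame_nmem[OF f3] frame_rmem[OF f3]
  have set_reps: "nmem s3 ''r'' ` {0..<nmem s3 ''K'' 0} = R"
    using arg_cong[OF reps, of set] qR by (auto simp: R)
  have dist_reps: "distinct (map (nmem s3 ''r'') [0..<nmem s3 ''K'' 0])" unfolding reps by simp
  then have inj: "inj_on (nmem s3 ''r'') {0..<nmem s3 ''K'' 0}" by (simp add: distinct_map)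
  then have Kk: "nmem s3 ''K'' 0 = Suc k"
    using card_image[OF inj] k unfolding set_reps by simp
  define r where "r = nmem s3 ''r''"
  have r: "inj_on r {..k}" "r ` {..k} = R"
    using inj set_reps unfolding Kk r_def by (simp_all add: atLeast0LessThan lessThan_Suc_atMost)
  define s4 where "s4 = nwrite ''k'' 0 k s3"
  have e4: "exec (nset ''k'' (NMinus (nvar ''K'') (NConst 1))) s3 6 s4"
    using exec.NAssign[of "''k''" "NConst 0" "NMinus (nvar ''K'') (NConst 1)" s3] Kk
    by (simp add: s4_def eval_nat_numeral)
  have k4: "nmem s4 ''k'' 0 = k" by (simp add: s4_def mem_simps)
  obtain t5 s5 where e5: "exec powers s4 t5 s5" and t5: "t5 \<le> k * 40 + 20"
    and M: "nmem s5 ''M'' 0 = 2 ^ k" and w: "\<forall>i<k. nmem s5 ''w'' i = 2 ^ i" and f5: "frame powers s4 s5"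
    using wp_powers[OF k4] by (elim wpE) blast
  note fr5 = frame_nmem[OF f5] frame_rmem[OF f5]
  have "wp (multiples ''b'' ''M'' ''K'')
      (\<lambda>t s'. t \<le> 2 ^ k * 30 + 20 \<and> (\<forall>S<2 ^ k. nmem s' ''b'' S = S * Suc k)) s5"
    by (rule wp_multiples) (use M Kk in \<open>auto simp: fr5 writes s4_def mem_simps\<close>)
  then obtain t6 s6 where e6: "exec (multiples ''b'' ''M'' ''K'') s5 t6 s6" and t6: "t6 \<le> 2 ^ k * 30 + 20"
    and b: "\<forall>S<2 ^ k. nmem s6 ''b'' S = S * Suc k" and f6: "frame (multiples ''b'' ''M'' ''K'') s5 s6"
    by (elim wpE) blast
  note fr6 = frame_nmem[OF f6] frame_rmem[OF f6] fr5 s4_def mem_simps fr3 writes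
  have r6: "nmem s6 ''r'' = r" by (simp add: fr6 r_def)
  have "r j < n" if "j \<le> k" for j using r(2) that by (auto simp: R)
  then have ready6: "hk_ready n d k s6"
    using inst2 M w b Kk r6 by (simp add: hk_ready_def instance_at_def fr6)
  obtain t7 s7 where e7: "exec held_karp s6 t7 s7"
    and t7: "t7 \<le> 2 ^ k * (Suc k * (Suc k * 120 + 90) + 60) + 20"
    and hk: "hk_rows d r k (gtab k s7) (atab k s7) (2 ^ k)" and f7: "frame held_karp s6 s7"
    using wp_held_karp[OF ready6 r6] by (elim wpE) blast
  note fr7 = frame_nmem[OF f7] frame_rmem[OF f7] nwrites_held_karp
  have ready7: "hk_ready n d k s7"
    using ready6 by (subst hk_ready_cong[of s7 s6]) (auto simp: fr7)
  have r7: "nmem s7 ''r'' = r" using r6 by (simp add: fr7)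
  define B where "B = gtab k s7 (2 ^ k - 1) k"
  obtain t8 s8 where e8: "exec follow_hk s7 t8 s8" and t8: "t8 \<le> k * 80 + 60"
    and cyc8: "cyclic_succ R (nmem s8 ''s'')" and cost8: "(\<Sum>v\<in>R. d (v, nmem s8 ''s'' v)) = B"
    and f8: "frame follow_hk s7 s8"
    using wp_follow_hk[OF ready7 r7 r(1) hk] unfolding r(2) B_def by (elim wpE) blast
  note fr8 = frame_nmem[OF f8] frame_rmem[OF f8] fr7 fr6
  have q8: "nmem s8 ''q'' = nmem s2 ''q''" and p8: "nmem s8 ''p'' = p" and n8: "nmem s8 ''n'' 0 = n"
    using inst2 by (simp_all add: fr8 p_def instance_at_def)
  have "{v. v < n \<and> nmem s8 ''q'' v = 0} = R" using qR by (auto simp: q8 R)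
  then have part8: "partial_tour n d (nmem s8 ''p'') R B s8"
    using cyc8 cost8 by (simp add: partial_tour_def)
  have "wp insert_vertices (\<lambda>t s'. t \<le> n * (n * 80 + 40) + 20 \<and> partial_tour n d (nmem s8 ''p'') R B s' \<and>
    (\<forall>v<n. nmem s' ''q'' v = 0)) s8"
    by (rule wp_insert_vertices[OF d n8 part8 _ h(2)]) (use p h(1) in \<open>auto simp: q8 p8\<close>)
  then obtain t9 s9 where e9: "exec insert_vertices s8 t9 s9" and t9: "t9 \<le> n * (n * 80 + 40) + 20"
    and part9: "partial_tour n d p R B s9" and q9: "\<forall>v<n. nmem s9 ''q'' v = 0"
    and f9: "frame insert_vertices s8 s9"
    unfolding p8 by (elim wpE) blast
  note fr9 = frame_nmem[OF f9] frame_rmem[OF f9] writes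
  have "{v. v < n \<and> nmem s9 ''q'' v = 0} = {0..<n}" using q9 by auto
  then have cyc9: "cyclic_succ {0..<n} (nmem s9 ''s'')"
    and cost9: "(\<Sum>v=0..<n. d (v, nmem s9 ''s'' v)) \<le> B + (\<Sum>v\<in>{0..<n} - R. d (p v, v) + d (v, p v))"
    using part9 by (simp_all add: partial_tour_def Let_def)
  have n9: "nmem s9 ''n'' 0 = n" using n8 by (simp add: fr9)
  have start: "nmem s9 ''r'' (nmem s9 ''k'' 0) = r k"
    using ready7 r7 by (simp add: fr9 frame_nmem[OF f8] hk_ready_def)
  obtain t10 s10 where e10: "exec write_tour s9 t10 s10" and t10: "t10 \<le> n * 50 + 30"
    and tour: "map (nmem s10 ''tour'') [0..<n] = map (\<lambda>i. (nmem s9 ''s'' ^^ i) (r k)) [0..<n]"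
    using wp_write_tour[OF n9] unfolding start by (elim wpE) blast
  have "r k \<in> R" using r(2) by blast
  then have "r k \<in> {0..<n}" by (simp add: R)
  then obtain ys where ys: "distinct (r k # ys)" "set (r k # ys) = {0..<n}"
    "map (nmem s9 ''s'') (r k # ys) = ys @ [r k]"
    using cyc9 by (elim cyclic_succE)
  define xs where "xs = r k # ys"
  have xs: "distinct xs" "set xs = {0..<n}" "map (nmem s9 ''s'') xs = rotate1 xs"
    using ys by (simp_all add: xs_def)
  have "length xs = n" using distinct_card[OF xs(1)] xs(2) by simp
  then have out: "map (nmem s10 ''tour'') [0..<n] = xs"
    using rotate1_eq_successors[OF xs(3)] tour by (simp add: xs_def)
  have cost: "sum_list (map d (zip xs (rotate1 xs))) \<le>
      B + (\<Sum>v\<in>{0..<n} - R. d (p v, v) + d (v, p v))"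
    using cost9 by (simp only: sum_list_cycle[OF xs(1,3)] xs(2))
  have B: "B \<le> walk_cost d (r k) (zs @ [r k])" if "distinct (r k # zs)" "set (r k # zs) = R" for zs
    unfolding B_def by (rule hk_rows_start_le[OF hk that[folded r(2)] r(1)])
  have par: "\<forall>v\<in>{0..<n} - R. p v < n \<and> K (p v) v" using p qR by auto
  have fin: "\<forall>zs. distinct (r k # zs) \<longrightarrow> set (r k # zs) = R \<longrightarrow> sum_list (map d (zip xs (rotate1 xs))) \<le>
      walk_cost d (r k) (zs @ [r k]) + (\<Sum>v\<in>{0..<n} - R. d (p v, v) + d (v, p v))"
    by (intro allI impI order_trans[OF cost] add_right_mono B)
  have exec: "exec atsp_program s (t1 + (t2 + (t3 + (6 + (t5 + (t6 + (t7 + (t8 + (t9 + t10))))))))) s10"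
    unfolding atsp_program_def by (rule exec.Seq[OF e1], rule exec.Seq[OF e2], rule exec.Seq[OF e3], rule exec.Seq[OF e4],
      rule exec.Seq[OF e5], rule exec.Seq[OF e6], rule exec.Seq[OF e7], rule exec.Seq[OF e8],
      rule exec.Seq[OF e9 e10])
  have time: "t1 + (t2 + (t3 + (6 + (t5 + (t6 + (t7 + (t8 + (t9 + t10)))))))) \<le>
      2000 * (2 ^ (card R - 1) * card R ^ 2 + n ^ 2)"
  proof -
    \<comment> \<open>Every phase is bounded by a multiple of \<open>X\<close> or of
      \<open>n ^ 2\<close>. Each group sums to at most 600 times its term, so 2000 leaves
      slack.\<close>
    define X where "X = 2 ^ k * Suc k ^ 2"
    have "Suc k \<le> Suc k ^ 2" by (simp add: power2_eq_square)
    moreover have "Suc k ^ 2 \<le> X" unfolding X_def using mult_le_mono1[of 1 "2 ^ k" "Suc k ^ 2"] by simp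
    ultimately have 1: "k \<le> X" "1 \<le> X" by linarith+
    have 5: "2 ^ k \<le> X" "2 ^ k * Suc k \<le> X"
      unfolding X_def by (simp, rule mult_le_mono2, fact)
    have 2: "n \<le> n ^ 2" "1 \<le> n ^ 2" using n by (auto simp: power2_eq_square)
    have 3: "t7 \<le> 120 * X + 90 * (2 ^ k * Suc k) + 60 * 2 ^ k + 20"
      using t7 unfolding X_def by (simp add: algebra_simps power2_eq_square)
    have 4: "t2 \<le> 80 * n ^ 2 + 40 * n + 20" "t9 \<le> 80 * n ^ 2 + 40 * n + 20"
      using t2 t9 by (simp_all add: algebra_simps power2_eq_square)
    have "t5 + t6 + t7 + t8 + 6 \<le> 600 * X"
      using t5 t6 t8 3 1 5 by linarith
    moreover have "t1 + t2 + t3 + t9 + t10 \<le> 600 * n ^ 2"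
      using t1 t3 t10 4 2 by linarith
    moreover have "2 ^ (card R - 1) * card R ^ 2 = X" by (simp add: X_def k)
    ultimately show ?thesis by simp
  qed
  show ?thesis
    unfolding wp_def using exec time out xs(1,2) \<open>r k \<in> R\<close> par fin by blast
qed

text \<open>With \<open>k + 1\<close> roots the factor 4 comes from
  \<open>k + 1 \<le> 2 * k\<close>. For \<open>k = 0\<close> the term \<open>2 ^ k * k ^ 2\<close>
  vanishes, and the left-over 1 is absorbed by \<open>n ^ 2\<close>.\<close>

lemma time_bound_shift:
  fixes k m n :: nat
  assumes "m \<le> k + 1" "1 \<le> n"
  shows "2 ^ (m - 1) * m ^ 2 + n ^ 2 \<le> 4 * (2 ^ k * k ^ 2 + n ^ 2)"
proof -
  have le: "2 ^ (m - 1) * m ^ 2 \<le> 2 ^ k * (k + 1) ^ 2"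
    using assms(1) by (intro mult_le_mono power_increasing power_mono) auto
  show ?thesis
  proof (cases "k = 0")
    case True
    then have "2 ^ (m - 1) * m ^ 2 \<le> 1" using le by simp
    also have "1 \<le> n ^ 2" using assms(2) by simp
    finally show ?thesis by simp
  next
    case False
    then have "(k + 1) ^ 2 \<le> (2 * k) ^ 2" by (intro power_mono) auto
    then have "2 ^ k * (k + 1) ^ 2 \<le> 2 ^ k * (2 * k) ^ 2" by (rule mult_le_mono2)
    also have "\<dots> = 4 * (2 ^ k * k ^ 2)" by (simp add: power_mult_distrib)
    finally have "2 ^ (m - 1) * m ^ 2 \<le> 4 * (2 ^ k * k ^ 2)" using le by (rule order_trans[rotated])
    then show ?thesis by (rule order_trans[OF add_right_mono]) simp
  qed
qed

theorem theorem5p2: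
  shows "\<exists>(P :: com) (C :: nat).
    \<forall>(\<beta> :: real) (n :: nat) (G :: nat pair_pre_digraph) (c :: (nat \<times> nat) weight_fun)
     (A :: nat pair_pre_digraph) (k :: nat).
      \<beta> \<ge> 1 \<longrightarrow> n \<ge> 2 \<longrightarrow> pverts G = {0..<n} \<longrightarrow> metric_atsp G c \<longrightarrow>
      min_spanning_arborescence G c A \<longrightarrow> k = card {e \<in> parcs A. beta_one_way \<beta> c e} \<longrightarrow>
      (\<exists>t s. exec P (atsp_input \<beta> G c A) t s \<and>
             t \<le> C * (2 ^ k * k ^ 2 + n ^ 2) \<and>
             tour G (tour_output n s) \<and>
             tour_cost c (tour_output n s) \<le> (2 + \<beta>) * opt_cost G c)"
proof (rule exI[of _ atsp_program], rule exI[of _ 8000], intro allI impI)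
  fix \<beta> :: real and n k :: nat and G A :: "nat pair_pre_digraph" and c :: "(nat \<times> nat) weight_fun"
  assume \<beta>: "\<beta> \<ge> 1" and n: "n \<ge> 2" and V: "pverts G = {0..<n}" and G: "metric_atsp G c"
    and A: "min_spanning_arborescence G c A" and k: "k = card {e \<in> parcs A. beta_one_way \<beta> c e}"
  have n': "2 \<le> card (pverts G)" using n V by simp
  have arb: "spanning_arborescence G A" using A by (simp add: min_spanning_arborescence_def)
  note sub = spanning_arborescence_subset[OF arb]
  have arcs_G: "e \<in> parcs G \<longleftrightarrow> fst e < n \<and> snd e < n \<and> fst e \<noteq> snd e" for e
    unfolding metric_atspD(2)[OF G] V by auto
  have nonneg: "0 \<le> c e" if "e \<in> parcs G" for e using G that unfolding metric_atsp_def by blast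
  have AV: "parcs A \<subseteq> {0..<n} \<times> {0..<n}" using sub(2) arcs_G by fastforce
  have fin: "finite (parcs A)" by (rule finite_subset[OF AV]) simp
  have "acyclic (parcs A)"
    by (rule directed_tree_acyclic) (use arb sub(3) in \<open>auto simp: spanning_arborescence_def\<close>)
  then obtain h where h: "\<And>u v. (u, v) \<in> parcs A \<Longrightarrow> h u < h v" "\<And>v. v \<in> {0..<n} \<Longrightarrow> h v < card {0..<n}"
    using acyclic_rank[OF _ _ AV] by (metis finite_atLeastLessThan)
  obtain root where root: "\<And>v. v < n \<Longrightarrow> v \<noteq> root \<Longrightarrow> \<exists>u. (u, v) \<in> parcs A"
    using spanning_arborescence_in_arc[OF arb] sub(1) V by (metis atLeastLessThan_iff zero_le)
  \<comment> \<open>This is the content of the cost array: \<open>c\<close> on arcs and 0 on the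
    diagonal.\<close>
  define d where "d = (\<lambda>e. if e \<in> parcs G then c e else 0)"
  define K where "K u v \<longleftrightarrow> (u, v) \<in> parcs A \<and> \<not> \<beta> * d (u, v) < d (v, u)" for u v
  define R where "R = {v. v < n \<and> (\<forall>u<n. \<not> K u v)}"
  let ?W = "{e \<in> parcs A. beta_one_way \<beta> c e}"
  have arcA: "(u, v) \<in> parcs G" "(v, u) \<in> parcs G" if "(u, v) \<in> parcs A" for u v
    using that sub(2) arcs_G by force+
  \<comment> \<open>Apart from \<open>root\<close>, a vertex of \<open>R\<close> has an in-arc in
    \<open>A\<close> that was not kept and hence is counted by \<open>k\<close>. Taking heads of
    these arcs bounds \<open>card R\<close> by \<open>k + 1\<close>.\<close>
  have "v \<in> insert root (snd ` ?W)" if v: "v \<in> R" for v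
  proof (cases "v = root")
    case False
    then obtain u where u: "(u, v) \<in> parcs A" using root v by (auto simp: R_def)
    then have "u < n" "\<not> K u v" using AV v by (auto simp: R_def)
    then have "\<beta> * c (u, v) < c (v, u)" using u arcA[OF u] by (simp add: K_def d_def)
    then have "beta_one_way \<beta> c (u, v)" by (rule beta_one_wayI[OF \<beta>, where c = c and u = u and v = v, OF nonneg[OF arcA(1)[OF u]]])
    with u have "(u, v) \<in> ?W" by simp
    then have "v \<in> snd ` ?W" by (rule image_eqI[rotated]) simp
    then show ?thesis by (rule insertI2)
  qed simp
  then have "R \<subseteq> insert root (snd ` ?W)" by blast
  then have "card R \<le> card (insert root (snd ` ?W))" by (rule card_mono[rotated]) (simp add: fin)
  also have "\<dots> \<le> Suc (card (snd ` ?W))" by (simp add: card_insert_if fin)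
  also have "\<dots> \<le> k + 1" unfolding k by (simp add: card_image_le fin)
  finally have cardR: "card R \<le> k + 1" .
  have "wp atsp_program (\<lambda>t s'. t \<le> 2000 * (2 ^ (card R - 1) * card R ^ 2 + n ^ 2) \<and>
    (\<exists>xs p x. map (nmem s' ''tour'') [0..<n] = xs \<and> distinct xs \<and> set xs = {0..<n} \<and> x \<in> R \<and>
      (\<forall>v\<in>{0..<n} - R. p v < n \<and> K (p v) v) \<and>
      (\<forall>zs. distinct (x # zs) \<longrightarrow> set (x # zs) = R \<longrightarrow> sum_list (map d (zip xs (rotate1 xs))) \<le>
        walk_cost d x (zs @ [x]) + (\<Sum>v\<in>{0..<n} - R. d (p v, v) + d (v, p v))))) (atsp_input \<beta> G c A)"
  proof (rule wp_atsp_program[OF _ _ _ _ _ _ _ _ _ K_def R_def])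
    show "0 < n" using n by simp
    show "semimetric_on {0..<n} d" using semimetric_on_cost[OF G] by (simp add: d_def V)
    show "h u < h v" if "K u v" for u v using h(1) that by (simp add: K_def)
    show "h v < n" if "v < n" for v using h(2)[of v] that by simp
  qed (simp_all add: atsp_input_def V d_def)
  then obtain t s xs p x where exec: "exec atsp_program (atsp_input \<beta> G c A) t s"
    and t: "t \<le> 2000 * (2 ^ (card R - 1) * card R ^ 2 + n ^ 2)"
    and out: "map (nmem s ''tour'') [0..<n] = xs" and xs: "distinct xs" "set xs = {0..<n}" and x: "x \<in> R"
    and p: "\<forall>v\<in>{0..<n} - R. p v < n \<and> K (p v) v"
    and cost: "\<And>zs. distinct (x # zs) \<Longrightarrow> set (x # zs) = R \<Longrightarrow> sum_list (map d (zip xs (rotate1 xs))) \<le>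
        walk_cost d x (zs @ [x]) + (\<Sum>v\<in>{0..<n} - R. d (p v, v) + d (v, p v))"
    unfolding wp_def by blast
  have tour: "tour G (zip xs (rotate1 xs))" unfolding tour_eq_zip[OF G n'] using xs V by auto
  then have "set (zip xs (rotate1 xs)) \<subseteq> parcs G"
    by (auto simp: tour_def pre_digraph.cycle_def pre_digraph.awalk_def)
  then have "tour_cost c (zip xs (rotate1 xs)) = sum_list (map d (zip xs (rotate1 xs)))"
    unfolding tour_cost_def by (intro arg_cong[of _ _ sum_list] map_cong) (auto simp: d_def)
  moreover have "R \<subseteq> pverts G" by (auto simp: R_def V)
  then obtain zs where "distinct (x # zs)" "set (x # zs) = R" "walk_cost d x (zs @ [x]) \<le> opt_cost G c"
    using optimal_subtour[OF G n' d_def x] by blast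
  with cost have "sum_list (map d (zip xs (rotate1 xs))) \<le>
      opt_cost G c + (\<Sum>v\<in>{0..<n} - R. d (p v, v) + d (v, p v))" by fastforce
  moreover have "(\<Sum>v\<in>{0..<n} - R. d (p v, v) + d (v, p v)) \<le> (1 + \<beta>) * opt_cost G c"
  proof -
    have "d (p v, v) + d (v, p v) \<le> (1 + \<beta>) * c (p v, v)" and e: "(p v, v) \<in> parcs A"
      if "v \<in> {0..<n} - R" for v
    proof -
      show e: "(p v, v) \<in> parcs A" using p that by (auto simp: K_def)
      have "d (v, p v) \<le> \<beta> * d (p v, v)" using p that by (auto simp: K_def not_less)
      then show "d (p v, v) + d (v, p v) \<le> (1 + \<beta>) * c (p v, v)"
        using arcA[OF e] by (simp add: d_def algebra_simps)
    qed
    then have "(\<Sum>v\<in>{0..<n} - R. d (p v, v) + d (v, p v)) \<le> (\<Sum>v\<in>{0..<n} - R. (1 + \<beta>) * c (p v, v))"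
      by (intro sum_mono) blast
    \<comment> \<open>Inserted vertices are charged to distinct arcs, since \<open>v\<close> is the
      head; non-negative costs then permit the sum over all of \<open>A\<close>.\<close>
    also have "\<dots> = (1 + \<beta>) * sum c ((\<lambda>v. (p v, v)) ` ({0..<n} - R))"
      by (simp add: sum_distrib_left sum.reindex inj_on_def)
    also have "\<dots> \<le> (1 + \<beta>) * sum c (parcs A)"
      using \<beta> e sub(2) nonneg by (intro mult_left_mono sum_mono2 fin) auto
    also have "\<dots> \<le> (1 + \<beta>) * opt_cost G c"
      using \<beta> min_spanning_arborescence_le_opt[OF G n' A] by (intro mult_left_mono) auto
    finally show ?thesis .
  qed
  ultimately have "tour_cost c (zip xs (rotate1 xs)) \<le> (2 + \<beta>) * opt_cost G c"
    by (simp add: algebra_simps)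
  \<comment> \<open>8000 is 2000 times the factor 4 lost in passing from the number of roots to
    \<open>k\<close>.\<close>
  moreover have "t \<le> 8000 * (2 ^ k * k ^ 2 + n ^ 2)"
    using t time_bound_shift[OF cardR, of n] n by simp
  moreover have "tour_output n s = zip xs (rotate1 xs)" by (simp add: tour_output_def out)
  ultimately show "\<exists>t s. exec atsp_program (atsp_input \<beta> G c A) t s \<and>
      t \<le> 8000 * (2 ^ k * k ^ 2 + n ^ 2) \<and> tour G (tour_output n s) \<and>
      tour_cost c (tour_output n s) \<le> (2 + \<beta>) * opt_cost G c"
    using exec tour by metis
qed

end
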